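(* Let $M$ be a right $R$-module and let $\mathcal{A}$ be a class of artinian right $R$-modules closed under isomorphisms and direct summands. If every submodule of $M$ is $\mathcal{A}$-projective, then the following conditions are equivalent: (1) $M$ is an $\mathcal{A}$-C3 module. (2) Every submodule $N\in\mathcal{A}$ of $M$ that is isomorphic to a direct summand of $M$ is itself a direct summand of $M$. (3) Whenever $X_1,X_2,\ldots,X_n$ are direct summands of $M$ and $X_1,X_2,\ldots,X_n\in\mathcal{A}$, then $\sum_{i=1}^n X_i$ is a direct summand of $M$.
   Context: $R$ is an associative ring with identity and modules are unitary right $R$-modules. $N\subset_d M$ means $N$ is a direct summand of $M$. A module $X$ is $N$-projective if for every right $R$-module $K$ and every epimorphism $N\to K$ the induced map $\mathrm{Hom}(X,N)\to\mathrm{Hom}(X,K)$ is surjective; $X$ is $\mathcal{A}$-projective if it is $N$-projective for all $N\in\mathcal{A}$. $M$ is an $\mathcal{A}$-C3 module if, whenever $A\in\mathcal{A}$ and $B\in\mathcal{A}$ are submodules of $M$ with $A\subset_d M$, $B\subset_d M$ and $A\cap B=0$, then $A\oplus B\subset_d M$. *)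

theory Defs
  imports "HOL-Algebra.Module" "HOL-Algebra.AbelCoset"
begin

text \<open>
  The record for modules is reused from the library, whose locale \<^locale>\<open>module\<close> is restricted to
  commutative rings.  The field \<^const>\<open>smult\<close> takes the scalar first, so for a right
  module \<open>r \<odot>\<^bsub>M\<^esub> x\<close> denotes the product \<open>x r\<close>; only the order of the factors in \<open>smult_assoc\<close>
  distinguishes right from left modules.  The fields \<open>mult\<close> and \<open>one\<close> of the record carry no
  meaning.
\<close>

locale right_module = R?: ring R + M?: abelian_group M
  for R :: "('r, 'c) ring_scheme" (structure) and M :: "('r, 'm, 'd) module_scheme" (structure) +
  assumes smult_closed:
      "\<lbrakk>r \<in> carrier R; x \<in> carrier M\<rbrakk> \<Longrightarrow> r \<odot>\<^bsub>M\<^esub> x \<in> carrier M"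
    and smult_l_distr:
      "\<lbrakk>r \<in> carrier R; s \<in> carrier R; x \<in> carrier M\<rbrakk>
        \<Longrightarrow> (r \<oplus> s) \<odot>\<^bsub>M\<^esub> x = r \<odot>\<^bsub>M\<^esub> x \<oplus>\<^bsub>M\<^esub> s \<odot>\<^bsub>M\<^esub> x"
    and smult_r_distr:
      "\<lbrakk>r \<in> carrier R; x \<in> carrier M; y \<in> carrier M\<rbrakk>
        \<Longrightarrow> r \<odot>\<^bsub>M\<^esub> (x \<oplus>\<^bsub>M\<^esub> y) = r \<odot>\<^bsub>M\<^esub> x \<oplus>\<^bsub>M\<^esub> r \<odot>\<^bsub>M\<^esub> y"
    and smult_assoc:
      "\<lbrakk>r \<in> carrier R; s \<in> carrier R; x \<in> carrier M\<rbrakk>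
        \<Longrightarrow> (r \<otimes> s) \<odot>\<^bsub>M\<^esub> x = s \<odot>\<^bsub>M\<^esub> (r \<odot>\<^bsub>M\<^esub> x)"
    and smult_one:
      "x \<in> carrier M \<Longrightarrow> \<one> \<odot>\<^bsub>M\<^esub> x = x"

abbreviation restrict_mod :: "('r, 'm, 'd) module_scheme \<Rightarrow> 'm set \<Rightarrow> ('r, 'm, 'd) module_scheme" where
  "restrict_mod M N \<equiv> M\<lparr>carrier := N\<rparr>"

definition mod_hom ::
    "('r, 'c) ring_scheme \<Rightarrow> ('r, 'm, 'd) module_scheme \<Rightarrow> ('r, 'n, 'e) module_scheme \<Rightarrow> ('m \<Rightarrow> 'n) set"
  where
  "mod_hom R M N = {f \<in> carrier M \<rightarrow> carrier N.
     (\<forall>x\<in>carrier M. \<forall>y\<in>carrier M. f (x \<oplus>\<^bsub>M\<^esub> y) = f x \<oplus>\<^bsub>N\<^esub> f y) \<and>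
     (\<forall>r\<in>carrier R. \<forall>x\<in>carrier M. f (r \<odot>\<^bsub>M\<^esub> x) = r \<odot>\<^bsub>N\<^esub> f x)}"

definition mod_epi ::
    "('r, 'c) ring_scheme \<Rightarrow> ('r, 'm, 'd) module_scheme \<Rightarrow> ('r, 'n, 'e) module_scheme \<Rightarrow> ('m \<Rightarrow> 'n) set"
  where
  "mod_epi R M N = {f \<in> mod_hom R M N. f ` carrier M = carrier N}"

definition mod_iso ::
    "('r, 'c) ring_scheme \<Rightarrow> ('r, 'm, 'd) module_scheme \<Rightarrow> ('r, 'n, 'e) module_scheme \<Rightarrow> ('m \<Rightarrow> 'n) set"
  where
  "mod_iso R M N = {f \<in> mod_hom R M N. bij_betw f (carrier M) (carrier N)}"

definition mod_isomorphic ::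
    "('r, 'c) ring_scheme \<Rightarrow> ('r, 'm, 'd) module_scheme \<Rightarrow> ('r, 'n, 'e) module_scheme \<Rightarrow> bool"
  where
  "mod_isomorphic R M N \<longleftrightarrow> mod_iso R M N \<noteq> {}"

definition direct_summand :: "'m set \<Rightarrow> ('r, 'c) ring_scheme \<Rightarrow> ('r, 'm, 'd) module_scheme \<Rightarrow> bool" where
  "direct_summand N R M \<longleftrightarrow> submodule N R M \<and>
     (\<exists>L. submodule L R M \<and> N \<inter> L = {\<zero>\<^bsub>M\<^esub>} \<and> N <+>\<^bsub>M\<^esub> L = carrier M)"

definition artinian_module :: "('r, 'c) ring_scheme \<Rightarrow> ('r, 'm, 'd) module_scheme \<Rightarrow> bool" where
  "artinian_module R M \<longleftrightarrow>
     (\<forall>S :: nat \<Rightarrow> 'm set. (\<forall>i. submodule (S i) R M \<and> S (Suc i) \<subseteq> S i) \<longrightarrow> (\<exists>k. \<forall>i\<ge>k. S i = S k))"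

text \<open>
  The module \<open>K\<close> below ranges over modules whose elements have the same type as those of \<open>N\<close>.
  An epimorphic image of \<open>N\<close> always has an isomorphic copy there, so this entails the lifting
  property for all modules \<open>K\<close> over all types; see \<open>rel_projective_lift\<close>.
\<close>

definition rel_projective ::
    "('r, 'c) ring_scheme \<Rightarrow> ('r, 'm) module \<Rightarrow> ('r, 'x, 'e) module_scheme \<Rightarrow> bool"
  where
  "rel_projective R N X \<longleftrightarrow>
     (\<forall>K :: ('r, 'm) module. right_module R K \<longrightarrow>
       (\<forall>g\<in>mod_epi R N K. \<forall>f\<in>mod_hom R X K. \<exists>h\<in>mod_hom R X N. \<forall>x\<in>carrier X. g (h x) = f x))"

text \<open>
  A class of modules is a set of module records over one arbitrary element type, which plays the
  role of the universe; a submodule \<open>N\<close> of \<open>M\<close> belongs to the class if \<open>restrict_mod M N\<close> does.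
\<close>

definition class_projective ::
    "('r, 'c) ring_scheme \<Rightarrow> ('r, 'm) module set \<Rightarrow> ('r, 'x, 'e) module_scheme \<Rightarrow> bool"
  where
  "class_projective R \<A> X \<longleftrightarrow> (\<forall>N\<in>\<A>. rel_projective R N X)"

definition closed_under_iso :: "('r, 'c) ring_scheme \<Rightarrow> ('r, 'm) module set \<Rightarrow> bool" where
  "closed_under_iso R \<A> \<longleftrightarrow>
     (\<forall>N\<in>\<A>. \<forall>N' :: ('r, 'm) module. right_module R N' \<and> mod_isomorphic R N N' \<longrightarrow> N' \<in> \<A>)"

definition closed_under_summands :: "('r, 'c) ring_scheme \<Rightarrow> ('r, 'm) module set \<Rightarrow> bool" where
  "closed_under_summands R \<A> \<longleftrightarrow> (\<forall>N\<in>\<A>. \<forall>L. direct_summand L R N \<longrightarrow> restrict_mod N L \<in> \<A>)"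

definition class_C3 :: "('r, 'c) ring_scheme \<Rightarrow> ('r, 'm) module set \<Rightarrow> ('r, 'm) module \<Rightarrow> bool" where
  "class_C3 R \<A> M \<longleftrightarrow>
     (\<forall>A B. restrict_mod M A \<in> \<A> \<and> restrict_mod M B \<in> \<A> \<and>
        direct_summand A R M \<and> direct_summand B R M \<and> A \<inter> B = {\<zero>\<^bsub>M\<^esub>}
        \<longrightarrow> direct_summand (A <+>\<^bsub>M\<^esub> B) R M)"

definition submodule_sum :: "('r, 'm, 'd) module_scheme \<Rightarrow> nat \<Rightarrow> (nat \<Rightarrow> 'm set) \<Rightarrow> 'm set" where
  "submodule_sum M n X = {\<Oplus>\<^bsub>M\<^esub>i\<in>{1..n}. x i | x. \<forall>i\<in>{1..n}. x i \<in> X i}"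

lemma rel_projective_lift:
  fixes R :: "('r, 'c) ring_scheme" and N :: "('r, 'm) module"
    and X :: "('r, 'x, 'e) module_scheme" and K :: "('r, 'k, 'f) module_scheme"
  assumes proj: "rel_projective R N X" and K: "right_module R K"
    and g: "g \<in> mod_epi R N K" and f: "f \<in> mod_hom R X K"
  shows "\<exists>h\<in>mod_hom R X N. \<forall>x\<in>carrier X. g (h x) = f x"
proof -
  interpret K: right_module R K by (rule K)
  define s where "s = inv_into (carrier N) g"
  have im: "g ` carrier N = carrier K" using g by (simp add: mod_epi_def)
  have gs [simp]: "g (s y) = y" if "y \<in> carrier K" for y
    using that im unfolding s_def by (metis f_inv_into_f)
  have inj: "inj_on s (carrier K)" by (metis gs inj_onI)
  have g_closed [simp]: "g x \<in> carrier K" if "x \<in> carrier N" for x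
    using that im by auto
  define C :: "('r, 'm) module" where
    "C = \<lparr>carrier = s ` carrier K, mult = (\<lambda>a b. a), one = s \<zero>\<^bsub>K\<^esub>, zero = s \<zero>\<^bsub>K\<^esub>,
          add = (\<lambda>a b. s (g a \<oplus>\<^bsub>K\<^esub> g b)), smult = (\<lambda>r a. s (r \<odot>\<^bsub>K\<^esub> g a))\<rparr>"
  have [simp]: "carrier C = s ` carrier K" "zero C = s \<zero>\<^bsub>K\<^esub>" "add C a b = s (g a \<oplus>\<^bsub>K\<^esub> g b)"
    "smult C r a = s (r \<odot>\<^bsub>K\<^esub> g a)" for a b r
    by (simp_all add: C_def)
  have "abelian_group C"
  proof (rule abelian_groupI)
    fix x assume "x \<in> carrier C"
    then obtain y where "y \<in> carrier K" "x = s y" by auto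
    then have "s (\<ominus>\<^bsub>K\<^esub> y) \<in> carrier C" "s (\<ominus>\<^bsub>K\<^esub> y) \<oplus>\<^bsub>C\<^esub> x = \<zero>\<^bsub>C\<^esub>"
      by (auto simp: K.M.l_neg)
    then show "\<exists>y\<in>carrier C. y \<oplus>\<^bsub>C\<^esub> x = \<zero>\<^bsub>C\<^esub>" by blast
  qed (auto simp: K.M.add.m_ac)
  then have C: "right_module R C"
    by (intro right_module.intro right_module_axioms.intro K.R.ring_axioms)
       (auto simp: K.smult_closed K.smult_l_distr K.smult_r_distr K.smult_assoc K.smult_one)
  have "(s \<circ> g) ` carrier N = carrier C"
    by (simp only: image_comp[symmetric] im) simp
  moreover have "s \<circ> g \<in> mod_hom R N C"
    using g by (auto simp: mod_epi_def mod_hom_def)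
  ultimately have "s \<circ> g \<in> mod_epi R N C"
    by (simp add: mod_epi_def)
  moreover have "s \<circ> f \<in> mod_hom R X C"
    using f by (auto simp: mod_hom_def Pi_iff)
  ultimately obtain h where h: "h \<in> mod_hom R X N"
    and eq: "\<forall>x\<in>carrier X. (s \<circ> g) (h x) = (s \<circ> f) x"
    using proj C unfolding rel_projective_def by blast
  have "g (h x) = f x" if x: "x \<in> carrier X" for x
  proof -
    have "g (h x) \<in> carrier K" "f x \<in> carrier K"
      using h f x by (auto simp: mod_hom_def Pi_iff)
    then show ?thesis using eq x inj by (auto dest: inj_onD)
  qed
  with h show ?thesis by blast
qed

end

theory Submission
  imports Defs
begin

text \<open>
  Since submodules of \<open>M\<close> are \<open>\<A>\<close>-projective, every homomorphism from a submodule \<open>P \<in> \<A>\<close> to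
  \<open>M\<close> splits, so its kernel and its image are isomorphic to complementary summands of \<open>P\<close>.

  For (1) to (2), let \<open>f : N \<rightarrow> X\<close> be an isomorphism onto a summand and \<open>D = N \<inter> X\<close>, the kernel of
  the projection of \<open>N\<close> along \<open>X\<close>.  Then \<open>N = D \<oplus> N'\<close>, and \<open>N'\<close> is a summand of \<open>M\<close> because it is
  disjoint from the isomorphic summand \<open>f N'\<close>.  If \<open>f D \<noteq> X\<close>, then \<open>D\<close> is a summand by induction
  along the descending chain condition, and C3 applies to \<open>D\<close> and \<open>N'\<close>; if \<open>f D = X\<close>, then
  \<open>N \<subseteq> X\<close> and \<open>N = X\<close>, since injective endomorphisms of artinian modules are surjective.
\<close>

section \<open>Arithmetic in a right module\<close>

context right_module
begin

lemma smult_zero_l: "x \<in> carrier M \<Longrightarrow> \<zero> \<odot>\<^bsub>M\<^esub> x = \<zero>\<^bsub>M\<^esub>"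
  using smult_l_distr[of \<zero> \<zero> x] smult_closed[of \<zero> x] M.add.r_cancel_one[of "\<zero> \<odot>\<^bsub>M\<^esub> x" "\<zero> \<odot>\<^bsub>M\<^esub> x"]
  by simp

text \<open>Turns negation into multiplication by a scalar, so that whatever respects addition and
  scalars also respects negatives; \<open>submoduleI\<close> and
  \<open>hom_restrict_zero_minus\<close> rely on this.\<close>

lemma smult_minus_one:
  assumes x: "x \<in> carrier M" shows "(\<ominus> \<one>) \<odot>\<^bsub>M\<^esub> x = \<ominus>\<^bsub>M\<^esub> x"
proof -
  have "(\<ominus> \<one>) \<odot>\<^bsub>M\<^esub> x \<oplus>\<^bsub>M\<^esub> x = (\<ominus> \<one> \<oplus> \<one>) \<odot>\<^bsub>M\<^esub> x"
    using x by (simp add: smult_l_distr smult_one)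
  also have "\<dots> = \<zero>\<^bsub>M\<^esub>" using x by (simp add: R.l_neg smult_zero_l)
  finally show ?thesis using x by (metis M.minus_equality smult_closed R.a_inv_closed R.one_closed)
qed

text \<open>Sorting a sum with \<open>M.a_ac\<close> may leave \<open>x\<close> and its negative
  apart. These rules cancel across one or two intervening terms, whereas \<open>M.r_neg1\<close> and
  \<open>M.r_neg2\<close> cancel neighbours.\<close>

lemma minus_cancel:
  assumes "x \<in> carrier M" "y \<in> carrier M" "z \<in> carrier M"
  shows "x \<oplus>\<^bsub>M\<^esub> (y \<oplus>\<^bsub>M\<^esub> \<ominus>\<^bsub>M\<^esub> x) = y" "\<ominus>\<^bsub>M\<^esub> x \<oplus>\<^bsub>M\<^esub> (y \<oplus>\<^bsub>M\<^esub> x) = y"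
    and "x \<oplus>\<^bsub>M\<^esub> (y \<oplus>\<^bsub>M\<^esub> (\<ominus>\<^bsub>M\<^esub> x \<oplus>\<^bsub>M\<^esub> z)) = y \<oplus>\<^bsub>M\<^esub> z"
    and "\<ominus>\<^bsub>M\<^esub> x \<oplus>\<^bsub>M\<^esub> (y \<oplus>\<^bsub>M\<^esub> (x \<oplus>\<^bsub>M\<^esub> z)) = y \<oplus>\<^bsub>M\<^esub> z"
    and "x \<oplus>\<^bsub>M\<^esub> (y \<oplus>\<^bsub>M\<^esub> (z \<oplus>\<^bsub>M\<^esub> \<ominus>\<^bsub>M\<^esub> x)) = y \<oplus>\<^bsub>M\<^esub> z"
    and "\<ominus>\<^bsub>M\<^esub> x \<oplus>\<^bsub>M\<^esub> (y \<oplus>\<^bsub>M\<^esub> (z \<oplus>\<^bsub>M\<^esub> x)) = y \<oplus>\<^bsub>M\<^esub> z"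
proof -
  have 1: "x \<oplus>\<^bsub>M\<^esub> (v \<oplus>\<^bsub>M\<^esub> \<ominus>\<^bsub>M\<^esub> x) = v" "\<ominus>\<^bsub>M\<^esub> x \<oplus>\<^bsub>M\<^esub> (v \<oplus>\<^bsub>M\<^esub> x) = v" if "v \<in> carrier M" for v
    using that assms(1) M.a_lcomm[of x v "\<ominus>\<^bsub>M\<^esub> x"] M.a_lcomm[of "\<ominus>\<^bsub>M\<^esub> x" v x]
    by (simp_all add: M.r_neg M.l_neg)
  then show "x \<oplus>\<^bsub>M\<^esub> (y \<oplus>\<^bsub>M\<^esub> \<ominus>\<^bsub>M\<^esub> x) = y" "\<ominus>\<^bsub>M\<^esub> x \<oplus>\<^bsub>M\<^esub> (y \<oplus>\<^bsub>M\<^esub> x) = y"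
    using assms(2) by auto
  show "x \<oplus>\<^bsub>M\<^esub> (y \<oplus>\<^bsub>M\<^esub> (z \<oplus>\<^bsub>M\<^esub> \<ominus>\<^bsub>M\<^esub> x)) = y \<oplus>\<^bsub>M\<^esub> z"
    "\<ominus>\<^bsub>M\<^esub> x \<oplus>\<^bsub>M\<^esub> (y \<oplus>\<^bsub>M\<^esub> (z \<oplus>\<^bsub>M\<^esub> x)) = y \<oplus>\<^bsub>M\<^esub> z"
    using 1[of "y \<oplus>\<^bsub>M\<^esub> z"] assms by (simp_all add: M.a_assoc)
  then show "x \<oplus>\<^bsub>M\<^esub> (y \<oplus>\<^bsub>M\<^esub> (\<ominus>\<^bsub>M\<^esub> x \<oplus>\<^bsub>M\<^esub> z)) = y \<oplus>\<^bsub>M\<^esub> z"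
    "\<ominus>\<^bsub>M\<^esub> x \<oplus>\<^bsub>M\<^esub> (y \<oplus>\<^bsub>M\<^esub> (x \<oplus>\<^bsub>M\<^esub> z)) = y \<oplus>\<^bsub>M\<^esub> z"
    using assms by (simp_all add: M.a_comm[of z])
qed

lemma minus_zero_right: "x \<in> carrier M \<Longrightarrow> x \<ominus>\<^bsub>M\<^esub> \<zero>\<^bsub>M\<^esub> = x"
  using M.minus_equality[of "\<zero>\<^bsub>M\<^esub>" "\<zero>\<^bsub>M\<^esub>"] by (simp add: a_minus_def)

lemma minus_eq_zeroD:
  assumes "x \<in> carrier M" "y \<in> carrier M" "x \<ominus>\<^bsub>M\<^esub> y = \<zero>\<^bsub>M\<^esub>" shows "x = y"
proof -
  have "x = (x \<ominus>\<^bsub>M\<^esub> y) \<oplus>\<^bsub>M\<^esub> y" using assms(1,2) by (simp add: a_minus_def M.a_assoc M.l_neg)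
  then show ?thesis using assms by simp
qed

section \<open>Submodules, their sums and intersections\<close>

lemma submoduleI:
  assumes "N \<subseteq> carrier M" "\<zero>\<^bsub>M\<^esub> \<in> N"
    and "\<And>x y. \<lbrakk>x \<in> N; y \<in> N\<rbrakk> \<Longrightarrow> x \<oplus>\<^bsub>M\<^esub> y \<in> N"
    and "\<And>r x. \<lbrakk>r \<in> carrier R; x \<in> N\<rbrakk> \<Longrightarrow> r \<odot>\<^bsub>M\<^esub> x \<in> N"
  shows "submodule N R M"
proof (intro submodule.intro subgroup.intro submodule_axioms.intro)
  \<comment> \<open>A submodule in the library is an additive subgroup, so closure under negatives
    has to be produced; it comes from the scalar -1.\<close>
  fix x assume "x \<in> N"
  then have "(\<ominus> \<one>) \<odot>\<^bsub>M\<^esub> x \<in> N" using assms(4) by simp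
  then show "inv\<^bsub>add_monoid M\<^esub> x \<in> N"
    using smult_minus_one[of x] assms(1) \<open>x \<in> N\<close> by (auto simp: a_inv_def)
qed (use assms in auto)

lemma submoduleD:
  assumes "submodule N R M"
  shows "N \<subseteq> carrier M" "\<And>x. x \<in> N \<Longrightarrow> x \<in> carrier M" "\<zero>\<^bsub>M\<^esub> \<in> N"
    and "\<And>x y. \<lbrakk>x \<in> N; y \<in> N\<rbrakk> \<Longrightarrow> x \<oplus>\<^bsub>M\<^esub> y \<in> N"
    and "\<And>x. x \<in> N \<Longrightarrow> \<ominus>\<^bsub>M\<^esub> x \<in> N"
    and "\<And>x y. \<lbrakk>x \<in> N; y \<in> N\<rbrakk> \<Longrightarrow> x \<ominus>\<^bsub>M\<^esub> y \<in> N"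
    and "\<And>r x. \<lbrakk>r \<in> carrier R; x \<in> N\<rbrakk> \<Longrightarrow> r \<odot>\<^bsub>M\<^esub> x \<in> N"
proof -
  interpret N: submodule N R M by (rule assms)
  show N: "N \<subseteq> carrier M" using N.subset by simp
  show "x \<in> carrier M" if "x \<in> N" for x using N that by blast
  show "\<zero>\<^bsub>M\<^esub> \<in> N" using N.one_closed by simp
  show a: "x \<oplus>\<^bsub>M\<^esub> y \<in> N" if "x \<in> N" "y \<in> N" for x y using N.m_closed[OF that] by simp
  show i: "\<ominus>\<^bsub>M\<^esub> x \<in> N" if "x \<in> N" for x using N.m_inv_closed[OF that] by (simp add: a_inv_def)
  show "x \<ominus>\<^bsub>M\<^esub> y \<in> N" if "x \<in> N" "y \<in> N" for x y
    using a[OF that(1) i[OF that(2)]] by (simp add: a_minus_def)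
  show "r \<odot>\<^bsub>M\<^esub> x \<in> N" if "r \<in> carrier R" "x \<in> N" for r x
    using N.smult_closed that by simp
qed

lemma right_module_restrict:
  assumes "submodule N R M" shows "right_module R (restrict_mod M N)"
proof -
  note N = submoduleD[OF assms]
  have "abelian_group (restrict_mod M N)"
  proof (rule abelian_groupI)
    show "\<exists>y\<in>carrier (restrict_mod M N). y \<oplus>\<^bsub>restrict_mod M N\<^esub> x = \<zero>\<^bsub>restrict_mod M N\<^esub>"
      if "x \<in> carrier (restrict_mod M N)" for x
      using that N(2,5) M.l_neg[of x] by (intro bexI[of _ "\<ominus>\<^bsub>M\<^esub> x"]) auto
  qed (use N(2-4) in \<open>auto simp: M.a_assoc intro: M.a_comm\<close>)
  then show ?thesis
    by (intro right_module.intro right_module_axioms.intro R.ring_axioms)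
       (use N in \<open>auto simp: smult_l_distr smult_r_distr smult_assoc smult_one\<close>)
qed

text \<open>\<open>restrict_mod\<close> changes the carrier alone, so zero, addition and scalars
  agree on both sides. This carries statements about the record \<open>restrict_mod M P\<close>,
  such as its chain condition, over to submodules of \<open>M\<close>.\<close>

lemma submodule_restrict_iff:
  assumes P: "submodule P R M"
  shows "submodule N R (restrict_mod M P) \<longleftrightarrow> submodule N R M \<and> N \<subseteq> P"
proof -
  interpret P: right_module R "restrict_mod M P" by (rule right_module_restrict[OF P])
  show ?thesis
  proof (intro iffI conjI)
    assume N: "submodule N R (restrict_mod M P)"
    note ND = P.submoduleD[OF N]
    show "N \<subseteq> P" using ND(1) by simp
    show "submodule N R M"
      by (rule submoduleI) (use ND submoduleD[OF P] in auto)
  next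
    assume N: "submodule N R M \<and> N \<subseteq> P"
    show "submodule N R (restrict_mod M P)"
      by (rule P.submoduleI) (use submoduleD[of N] N in auto)
  qed
qed

lemma set_add_iff: "z \<in> A <+>\<^bsub>M\<^esub> B \<longleftrightarrow> (\<exists>a\<in>A. \<exists>b\<in>B. z = a \<oplus>\<^bsub>M\<^esub> b)"
  by (auto simp: set_add_def set_mult_def)

lemma submodule_Int:
  "\<lbrakk>submodule A R M; submodule B R M\<rbrakk> \<Longrightarrow> submodule (A \<inter> B) R M"
  by (rule submoduleI) (auto simp: submoduleD)

lemma submodule_carrier: "submodule (carrier M) R M"
  by (rule submoduleI) (auto simp: smult_closed)

lemma submodule_zero: "submodule {\<zero>\<^bsub>M\<^esub>} R M"
proof (rule submoduleI)
  fix r x assume r: "r \<in> carrier R" and "x \<in> {\<zero>\<^bsub>M\<^esub>}"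
  then show "r \<odot>\<^bsub>M\<^esub> x \<in> {\<zero>\<^bsub>M\<^esub>}"
    using smult_r_distr[of r "\<zero>\<^bsub>M\<^esub>" "\<zero>\<^bsub>M\<^esub>"] smult_closed[of r "\<zero>\<^bsub>M\<^esub>"]
      M.add.r_cancel_one[of "r \<odot>\<^bsub>M\<^esub> \<zero>\<^bsub>M\<^esub>" "r \<odot>\<^bsub>M\<^esub> \<zero>\<^bsub>M\<^esub>"] by simp
qed auto

lemma submodule_set_add:
  assumes A: "submodule A R M" and B: "submodule B R M"
  shows "submodule (A <+>\<^bsub>M\<^esub> B) R M"
proof (rule submoduleI)
  note a = submoduleD[OF A] and b = submoduleD[OF B]
  show "A <+>\<^bsub>M\<^esub> B \<subseteq> carrier M" using a(2) b(2) by (auto simp: set_add_iff)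
  show "\<zero>\<^bsub>M\<^esub> \<in> A <+>\<^bsub>M\<^esub> B"
    unfolding set_add_iff using a(3) b(3) by (intro bexI[of _ "\<zero>\<^bsub>M\<^esub>"]) auto
  fix x y assume "x \<in> A <+>\<^bsub>M\<^esub> B" "y \<in> A <+>\<^bsub>M\<^esub> B"
  then obtain a1 b1 a2 b2 where *: "a1 \<in> A" "a2 \<in> A" "b1 \<in> B" "b2 \<in> B"
    and "x = a1 \<oplus>\<^bsub>M\<^esub> b1" "y = a2 \<oplus>\<^bsub>M\<^esub> b2" by (auto simp: set_add_iff)
  then have "x \<oplus>\<^bsub>M\<^esub> y = (a1 \<oplus>\<^bsub>M\<^esub> a2) \<oplus>\<^bsub>M\<^esub> (b1 \<oplus>\<^bsub>M\<^esub> b2)"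
    using a(2) b(2) by (simp add: M.a_ac)
  then show "x \<oplus>\<^bsub>M\<^esub> y \<in> A <+>\<^bsub>M\<^esub> B" using * a(4) b(4) unfolding set_add_iff by blast
next
  note a = submoduleD[OF A] and b = submoduleD[OF B]
  fix r x assume "r \<in> carrier R" "x \<in> A <+>\<^bsub>M\<^esub> B"
  then obtain a1 b1 where *: "a1 \<in> A" "b1 \<in> B" "x = a1 \<oplus>\<^bsub>M\<^esub> b1" "r \<in> carrier R"
    by (auto simp: set_add_iff)
  then have "r \<odot>\<^bsub>M\<^esub> x = (r \<odot>\<^bsub>M\<^esub> a1) \<oplus>\<^bsub>M\<^esub> (r \<odot>\<^bsub>M\<^esub> b1)"
    using a(2) b(2) by (simp add: smult_r_distr)
  then show "r \<odot>\<^bsub>M\<^esub> x \<in> A <+>\<^bsub>M\<^esub> B" using * a(7) b(7) unfolding set_add_iff by blast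
qed

lemma set_add_memI:
  assumes "submodule A R M" "submodule B R M"
  shows "x \<in> A \<Longrightarrow> x \<in> A <+>\<^bsub>M\<^esub> B" "x \<in> B \<Longrightarrow> x \<in> A <+>\<^bsub>M\<^esub> B"
proof -
  note a = submoduleD[OF assms(1)] and b = submoduleD[OF assms(2)]
  show "x \<in> A <+>\<^bsub>M\<^esub> B" if "x \<in> A"
    unfolding set_add_iff using that a(2,3) b(2,3)
    by (intro bexI[of _ x] bexI[of _ "\<zero>\<^bsub>M\<^esub>"]) auto
  show "x \<in> A <+>\<^bsub>M\<^esub> B" if "x \<in> B"
    unfolding set_add_iff using that a(2,3) b(2,3)
    by (intro bexI[of _ x] bexI[of _ "\<zero>\<^bsub>M\<^esub>"]) auto
qed

lemma set_add_subsetI: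
  assumes "submodule C R M" "A \<subseteq> C" "B \<subseteq> C" shows "A <+>\<^bsub>M\<^esub> B \<subseteq> C"
  using submoduleD(4)[OF assms(1)] assms(2,3) unfolding set_add_iff subset_iff by blast

section \<open>Internal direct sums and direct summands\<close>

text \<open>The decomposed module \<open>C\<close> is a set inside the ambient \<open>M\<close>, so
  that repeated decompositions do not nest restricted records. That \<open>C\<close> is a submodule
  follows from the two parts being submodules.\<close>

definition direct_sum_of :: "'m set \<Rightarrow> 'm set \<Rightarrow> 'm set \<Rightarrow> bool" where
  "direct_sum_of C A B \<longleftrightarrow>
     submodule A R M \<and> submodule B R M \<and> A \<inter> B = {\<zero>\<^bsub>M\<^esub>} \<and> A <+>\<^bsub>M\<^esub> B = C"

lemma direct_sum_ofI:
  assumes A: "submodule A R M" and B: "submodule B R M" and C: "submodule C R M"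
    and "\<And>x. \<lbrakk>x \<in> A; x \<in> B\<rbrakk> \<Longrightarrow> x = \<zero>\<^bsub>M\<^esub>"
    and "A \<subseteq> C" "B \<subseteq> C" "\<And>c. c \<in> C \<Longrightarrow> \<exists>a\<in>A. \<exists>b\<in>B. c = a \<oplus>\<^bsub>M\<^esub> b"
  shows "direct_sum_of C A B"
proof -
  have "A \<inter> B = {\<zero>\<^bsub>M\<^esub>}" using assms(4) submoduleD(3)[OF A] submoduleD(3)[OF B] by blast
  moreover have "A <+>\<^bsub>M\<^esub> B = C"
    using set_add_subsetI[OF C assms(5,6)] assms(7) by (auto simp: set_add_iff)
  ultimately show ?thesis using A B by (simp add: direct_sum_of_def)
qed

lemma direct_sum_ofD:
  assumes "direct_sum_of C A B"
  shows "submodule A R M" "submodule B R M" "submodule C R M" "A \<subseteq> C" "B \<subseteq> C"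
    and "\<And>x. \<lbrakk>x \<in> A; x \<in> B\<rbrakk> \<Longrightarrow> x = \<zero>\<^bsub>M\<^esub>"
    and "\<And>c. c \<in> C \<Longrightarrow> \<exists>a\<in>A. \<exists>b\<in>B. c = a \<oplus>\<^bsub>M\<^esub> b"
proof -
  show A: "submodule A R M" and B: "submodule B R M"
    using assms by (auto simp: direct_sum_of_def)
  have C: "A <+>\<^bsub>M\<^esub> B = C" and Int: "A \<inter> B = {\<zero>\<^bsub>M\<^esub>}"
    using assms by (auto simp: direct_sum_of_def)
  show "submodule C R M" using submodule_set_add[OF A B] C by simp
  show "A \<subseteq> C" "B \<subseteq> C" using set_add_memI[OF A B] C by auto
  show "x = \<zero>\<^bsub>M\<^esub>" if "x \<in> A" "x \<in> B" for x using that Int by blast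
  show "\<exists>a\<in>A. \<exists>b\<in>B. c = a \<oplus>\<^bsub>M\<^esub> b" if "c \<in> C" for c
    using that unfolding C[symmetric] set_add_iff .
qed

lemma direct_summand_iff: "direct_summand A R M \<longleftrightarrow> (\<exists>B. direct_sum_of (carrier M) A B)"
  by (auto simp: direct_summand_def direct_sum_of_def)

lemma direct_summand_restrict_iff:
  assumes P: "submodule P R M"
  shows "direct_summand A R (restrict_mod M P) \<longleftrightarrow> (\<exists>B. direct_sum_of P A B)"
proof -
  have eq: "A <+>\<^bsub>restrict_mod M P\<^esub> B = A <+>\<^bsub>M\<^esub> B" for A B
    by (simp add: set_add_def set_mult_def)
  show ?thesis
    unfolding direct_summand_def submodule_restrict_iff[OF P] eq
    using direct_sum_ofD(4,5)[of P A] by (simp add: direct_sum_of_def) metis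
qed

lemma direct_sum_of_commute:
  assumes "direct_sum_of C A B" shows "direct_sum_of C B A"
proof -
  note d = direct_sum_ofD[OF assms]
  show ?thesis
  proof (rule direct_sum_ofI)
    fix c assume "c \<in> C"
    then obtain a b where "a \<in> A" "b \<in> B" "c = a \<oplus>\<^bsub>M\<^esub> b" using d by blast
    moreover have "a \<oplus>\<^bsub>M\<^esub> b = b \<oplus>\<^bsub>M\<^esub> a"
      using calculation d(1,2) submoduleD(2) by (simp add: M.a_comm)
    ultimately show "\<exists>b\<in>B. \<exists>a\<in>A. c = b \<oplus>\<^bsub>M\<^esub> a" by blast
  qed (use d(1-6) in auto)
qed

lemma direct_sum_of_assoc:
  assumes CD: "direct_sum_of E C D" and AB: "direct_sum_of C A B"
  shows "direct_sum_of E A (B <+>\<^bsub>M\<^esub> D)"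
proof -
  note c = direct_sum_ofD[OF CD] and a = direct_sum_ofD[OF AB]
  note A = submoduleD[OF a(1)] and B = submoduleD[OF a(2)] and C = submoduleD[OF c(1)]
    and D = submoduleD[OF c(2)]
  show ?thesis
  proof (rule direct_sum_ofI)
    show "submodule (B <+>\<^bsub>M\<^esub> D) R M" using a(2) c(2) by (rule submodule_set_add)
    show "B <+>\<^bsub>M\<^esub> D \<subseteq> E" using a(5) c(3-5) by (intro set_add_subsetI) auto
  next
    fix x assume x: "x \<in> A" "x \<in> B <+>\<^bsub>M\<^esub> D"
    then obtain b d where bd: "b \<in> B" "d \<in> D" "x = b \<oplus>\<^bsub>M\<^esub> d" by (auto simp: set_add_iff)
    then have bdM: "b \<in> carrier M" "d \<in> carrier M" using B(2) D(2) by auto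
    \<comment> \<open>The element \<open>d\<close> is the difference of two elements of
      \<open>C\<close>, so it lies in both \<open>C\<close> and \<open>D\<close> and vanishes. Then
      \<open>x = b\<close> lies in both \<open>A\<close> and \<open>B\<close>.\<close>
    have "d = x \<ominus>\<^bsub>M\<^esub> b"
      unfolding bd(3) using bdM by (simp add: a_minus_def M.a_ac M.r_neg1 M.r_neg2 minus_cancel)
    also have "x \<ominus>\<^bsub>M\<^esub> b \<in> C" using bd(1) x(1) a(4,5) by (intro C(6)) auto
    finally have "d = \<zero>\<^bsub>M\<^esub>" using c(6)[OF _ bd(2)] by simp
    then have "x = b" using bd(3) bdM by simp
    then show "x = \<zero>\<^bsub>M\<^esub>" using a(6) x(1) bd(1) by simp
  next
    fix e assume "e \<in> E"
    then obtain u d where ud: "u \<in> C" "d \<in> D" "e = u \<oplus>\<^bsub>M\<^esub> d" using c by blast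
    then obtain x b where xb: "x \<in> A" "b \<in> B" "u = x \<oplus>\<^bsub>M\<^esub> b" using a by blast
    have "e = x \<oplus>\<^bsub>M\<^esub> (b \<oplus>\<^bsub>M\<^esub> d)"
      using ud xb A(2)[of x] B(2)[of b] D(2)[of d] by (simp add: M.a_assoc)
    then show "\<exists>x\<in>A. \<exists>y\<in>B <+>\<^bsub>M\<^esub> D. e = x \<oplus>\<^bsub>M\<^esub> y"
      using ud(2) xb(1,2) set_add_iff[of "b \<oplus>\<^bsub>M\<^esub> d" B D] by blast
  qed (use a(1,4) c(3,4) in auto)
qed

lemma direct_summand_trans:
  assumes "direct_summand C R M" "direct_sum_of C A B" shows "direct_summand A R M"
  using assms direct_sum_of_assoc unfolding direct_summand_iff by blast

text \<open>Here M is the direct sum of \<open>S\<close>, \<open>C\<close> and \<open>D\<close>;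
  regrouping the three terms makes \<open>D\<close> a complement of the sum of \<open>S\<close> and
  \<open>C\<close>.\<close>

lemma direct_summand_add:
  assumes ST: "direct_sum_of (carrier M) S T" and CD: "direct_sum_of T C D"
  shows "direct_summand (S <+>\<^bsub>M\<^esub> C) R M"
proof -
  have "direct_sum_of (carrier M) D (C <+>\<^bsub>M\<^esub> S)"
    using direct_sum_of_assoc[OF direct_sum_of_commute[OF ST] direct_sum_of_commute[OF CD]] .
  moreover have "C <+>\<^bsub>M\<^esub> S = S <+>\<^bsub>M\<^esub> C"
    using direct_sum_ofD(1)[OF CD] direct_sum_ofD(1)[OF ST] submoduleD(2) M.a_comm
    by (auto simp: set_add_iff) blast+
  ultimately show ?thesis
    unfolding direct_summand_iff using direct_sum_of_commute by metis
qed

text \<open>This is the modular law: a complement \<open>L\<close> of \<open>A\<close> in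
  \<open>M\<close> cuts out the complement \<open>C \<inter> L\<close> of \<open>A\<close> in
  \<open>C\<close>.\<close>

lemma direct_summand_within:
  assumes A: "direct_summand A R M" and C: "submodule C R M" and AC: "A \<subseteq> C"
  obtains B where "direct_sum_of C A B"
proof -
  obtain L where "direct_sum_of (carrier M) A L" using A by (auto simp: direct_summand_iff)
  note l = direct_sum_ofD[OF this]
  have "direct_sum_of C A (C \<inter> L)"
  proof (rule direct_sum_ofI)
    fix c assume c: "c \<in> C"
    then obtain a b where ab: "a \<in> A" "b \<in> L" "c = a \<oplus>\<^bsub>M\<^esub> b" using l(7) submoduleD(2)[OF C] by blast
    then have "b = c \<ominus>\<^bsub>M\<^esub> a"
      using subsetD[OF l(4), of a] subsetD[OF l(5), of b]
      by (simp add: a_minus_def M.a_ac M.r_neg1 M.r_neg2 minus_cancel)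
    also have "\<dots> \<in> C" using c ab AC by (intro submoduleD(6)[OF C]) auto
    finally show "\<exists>a\<in>A. \<exists>b\<in>C \<inter> L. c = a \<oplus>\<^bsub>M\<^esub> b" using ab by blast
  qed (use l(1,2,6) C AC submodule_Int in blast)+
  then show ?thesis by (rule that)
qed

section \<open>Homomorphisms defined on submodules\<close>

text \<open>Maps out of a submodule are given the target \<open>M\<close> throughout, with a
  separate statement about the image where it matters. Restricting the domain by
  \<open>hom_restrict_subset\<close> then leaves the target alone.\<close>

lemma hom_restrictD:
  assumes "f \<in> mod_hom R (restrict_mod M P) M"
  shows "\<And>x. x \<in> P \<Longrightarrow> f x \<in> carrier M"
    and "\<And>x y. \<lbrakk>x \<in> P; y \<in> P\<rbrakk> \<Longrightarrow> f (x \<oplus>\<^bsub>M\<^esub> y) = f x \<oplus>\<^bsub>M\<^esub> f y"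
    and "\<And>r x. \<lbrakk>r \<in> carrier R; x \<in> P\<rbrakk> \<Longrightarrow> f (r \<odot>\<^bsub>M\<^esub> x) = r \<odot>\<^bsub>M\<^esub> f x"
  using assms by (auto simp: mod_hom_def)

lemma hom_restrict_subset:
  "\<lbrakk>f \<in> mod_hom R (restrict_mod M P) M; Q \<subseteq> P\<rbrakk> \<Longrightarrow> f \<in> mod_hom R (restrict_mod M Q) M"
  by (auto simp: mod_hom_def subset_iff)

text \<open>\<open>mod_hom\<close> records only sums and scalar multiples. Zero is preserved by
  cancellation in f(0) = f(0) + f(0), and negatives by the scalar -1.\<close>

lemma hom_restrict_zero_minus:
  assumes f: "f \<in> mod_hom R (restrict_mod M P) M" and P: "submodule P R M"
  shows "f \<zero>\<^bsub>M\<^esub> = \<zero>\<^bsub>M\<^esub>" "\<And>x. x \<in> P \<Longrightarrow> f (\<ominus>\<^bsub>M\<^esub> x) = \<ominus>\<^bsub>M\<^esub> f x"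
    "\<And>x y. \<lbrakk>x \<in> P; y \<in> P\<rbrakk> \<Longrightarrow> f (x \<ominus>\<^bsub>M\<^esub> y) = f x \<ominus>\<^bsub>M\<^esub> f y"
proof -
  note h = hom_restrictD[OF f] and p = submoduleD[OF P]
  show "f \<zero>\<^bsub>M\<^esub> = \<zero>\<^bsub>M\<^esub>"
    using h(2)[of "\<zero>\<^bsub>M\<^esub>" "\<zero>\<^bsub>M\<^esub>"] p(3) h(1) M.add.r_cancel_one[of "f \<zero>\<^bsub>M\<^esub>" "f \<zero>\<^bsub>M\<^esub>"] by simp
  show neg: "f (\<ominus>\<^bsub>M\<^esub> x) = \<ominus>\<^bsub>M\<^esub> f x" if "x \<in> P" for x
    using h(3)[of "\<ominus> \<one>" x] that h(1) p(2) by (simp add: smult_minus_one)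
  show "f (x \<ominus>\<^bsub>M\<^esub> y) = f x \<ominus>\<^bsub>M\<^esub> f y" if "x \<in> P" "y \<in> P" for x y
    using that h(2)[of x "\<ominus>\<^bsub>M\<^esub> y"] p(5) neg by (simp add: a_minus_def)
qed

lemma submodule_image:
  assumes f: "f \<in> mod_hom R (restrict_mod M P) M" and P: "submodule P R M"
  shows "submodule (f ` P) R M"
proof (rule submoduleI)
  note h = hom_restrictD[OF f] and p = submoduleD[OF P]
  show "f ` P \<subseteq> carrier M" using h(1) by auto
  show "\<zero>\<^bsub>M\<^esub> \<in> f ` P" using hom_restrict_zero_minus(1)[OF f P] p(3) by force
  show "x \<oplus>\<^bsub>M\<^esub> y \<in> f ` P" if "x \<in> f ` P" "y \<in> f ` P" for x y
    using that h(2) p(4) by (auto simp flip: h(2))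
  show "r \<odot>\<^bsub>M\<^esub> x \<in> f ` P" if "r \<in> carrier R" "x \<in> f ` P" for r x
    using that p(7) by (auto simp flip: h(3))
qed

lemma submodule_kernel:
  assumes f: "f \<in> mod_hom R (restrict_mod M P) M" and P: "submodule P R M"
  shows "submodule {x \<in> P. f x = \<zero>\<^bsub>M\<^esub>} R M"
proof (rule submoduleI)
  note h = hom_restrictD[OF f] and p = submoduleD[OF P]
  show "\<zero>\<^bsub>M\<^esub> \<in> {x \<in> P. f x = \<zero>\<^bsub>M\<^esub>}" using hom_restrict_zero_minus(1)[OF f P] p(3) by force
  show "r \<odot>\<^bsub>M\<^esub> x \<in> {x \<in> P. f x = \<zero>\<^bsub>M\<^esub>}" if "r \<in> carrier R" "x \<in> {x \<in> P. f x = \<zero>\<^bsub>M\<^esub>}" for r x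
    using that h(3) p(7) submoduleD(7)[OF submodule_zero, of r "\<zero>\<^bsub>M\<^esub>"] by auto
qed (use hom_restrictD(2)[OF f] submoduleD(2,4)[OF P] in auto)

lemma hom_restrict_injI:
  assumes f: "f \<in> mod_hom R (restrict_mod M P) M" and P: "submodule P R M"
    and k: "\<And>x. \<lbrakk>x \<in> P; f x = \<zero>\<^bsub>M\<^esub>\<rbrakk> \<Longrightarrow> x = \<zero>\<^bsub>M\<^esub>"
  shows "inj_on f P"
proof (rule inj_onI)
  note h = hom_restrictD[OF f] and p = submoduleD[OF P]
  fix x y assume xy: "x \<in> P" "y \<in> P" "f x = f y"
  then have "f (x \<ominus>\<^bsub>M\<^esub> y) = \<zero>\<^bsub>M\<^esub>"
    using hom_restrict_zero_minus(3)[OF f P] h(1) by (simp add: a_minus_def M.r_neg)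
  then have "x \<ominus>\<^bsub>M\<^esub> y = \<zero>\<^bsub>M\<^esub>" using k p(6)[OF xy(1,2)] by simp
  then show "x = y" using xy p(2) minus_eq_zeroD by blast
qed

text \<open>The operations of \<open>Q\<close> are those of \<open>M\<close>, so a map with image
  \<open>Q\<close> is a homomorphism into \<open>Q\<close> exactly when it is one into
  \<open>M\<close>.\<close>

lemma mod_isomorphic_restrict_iff:
  assumes "submodule Q R M"
  shows "mod_isomorphic R (restrict_mod M P) (restrict_mod M Q) \<longleftrightarrow>
    (\<exists>f \<in> mod_hom R (restrict_mod M P) M. bij_betw f P Q)"
proof -
  have "f \<in> mod_hom R (restrict_mod M P) (restrict_mod M Q) \<longleftrightarrow> f \<in> mod_hom R (restrict_mod M P) M"
    if "f ` P = Q" for f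
    using that submoduleD(1)[OF assms] by (auto simp: mod_hom_def)
  then have "mod_iso R (restrict_mod M P) (restrict_mod M Q) =
      {f \<in> mod_hom R (restrict_mod M P) M. bij_betw f P Q}"
    unfolding mod_iso_def by (auto simp: bij_betw_def)
  then show ?thesis unfolding mod_isomorphic_def by blast
qed

lemma mod_isomorphic_image:
  assumes f: "f \<in> mod_hom R (restrict_mod M P) M" and P: "submodule P R M" and inj: "inj_on f P"
  shows "mod_isomorphic R (restrict_mod M P) (restrict_mod M (f ` P))"
  unfolding mod_isomorphic_restrict_iff[OF submodule_image[OF f P]]
  using f inj by (auto simp: bij_betw_def)

lemma hom_restrict_inverse:
  assumes f: "f \<in> mod_hom R (restrict_mod M P) M" and P: "submodule P R M" and b: "bij_betw f P Q"
  shows "inv_into P f \<in> mod_hom R (restrict_mod M Q) M" "bij_betw (inv_into P f) Q P"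
proof -
  note h = hom_restrictD[OF f] and p = submoduleD[OF P]
  show b': "bij_betw (inv_into P f) Q P" using b by (rule bij_betw_inv_into)
  have Q: "Q = f ` P" and inj: "inj_on f P" using b by (auto simp: bij_betw_def)
  have "inv_into P f (f x \<oplus>\<^bsub>M\<^esub> f y) = x \<oplus>\<^bsub>M\<^esub> y" if "x \<in> P" "y \<in> P" for x y
    using that inj p(4) by (simp flip: h(2))
  moreover have "inv_into P f (r \<odot>\<^bsub>M\<^esub> f x) = r \<odot>\<^bsub>M\<^esub> x" if "r \<in> carrier R" "x \<in> P" for r x
    using that inj p(7) by (simp flip: h(3))
  ultimately show "inv_into P f \<in> mod_hom R (restrict_mod M Q) M"
    using inj p(2) by (auto simp: mod_hom_def Q)
qed

lemma mod_isomorphic_sym: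
  assumes "submodule P R M" "submodule Q R M"
    and "mod_isomorphic R (restrict_mod M P) (restrict_mod M Q)"
  shows "mod_isomorphic R (restrict_mod M Q) (restrict_mod M P)"
  using assms hom_restrict_inverse mod_isomorphic_restrict_iff by metis

lemma direct_sum_of_image:
  assumes f: "f \<in> mod_hom R (restrict_mod M P) M" and inj: "inj_on f P"
    and d: "direct_sum_of P A B"
  shows "direct_sum_of (f ` P) (f ` A) (f ` B)"
proof -
  note h = hom_restrictD[OF f] and d = direct_sum_ofD[OF d]
  note P = submoduleD[OF d(3)]
  have fA: "f \<in> mod_hom R (restrict_mod M A) M" and fB: "f \<in> mod_hom R (restrict_mod M B) M"
    using f d(4,5) hom_restrict_subset by blast+
  show ?thesis
  proof (rule direct_sum_ofI)
    fix x assume "x \<in> f ` A" "x \<in> f ` B"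
    then obtain a b where ab: "a \<in> A" "b \<in> B" "x = f a" "x = f b" by blast
    then have "a = b" using inj d(4,5) by (auto dest: inj_onD)
    then have "a = \<zero>\<^bsub>M\<^esub>" using d(6)[of a] ab(1,2) by simp
    then show "x = \<zero>\<^bsub>M\<^esub>" using ab hom_restrict_zero_minus(1)[OF f d(3)] by simp
  next
    fix c assume "c \<in> f ` P"
    then obtain a b where ab: "a \<in> A" "b \<in> B" "c = f (a \<oplus>\<^bsub>M\<^esub> b)" using d(7) by blast
    then have "c = f a \<oplus>\<^bsub>M\<^esub> f b" using h(2) d(4,5) by blast
    then show "\<exists>x\<in>f ` A. \<exists>y\<in>f ` B. c = x \<oplus>\<^bsub>M\<^esub> y" using ab by blast
  qed (use d(3-5) submodule_image[OF fA d(1)] submodule_image[OF fB d(2)] submodule_image[OF f] in auto)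
qed

text \<open>The map \<open>p\<close> sends an element to its component in \<open>B\<close>. Its
  domain is written \<open>restrict_mod M (carrier M)\<close> so that the lemmas on maps out of
  submodules apply, in particular restriction to smaller domains.\<close>

lemma projection:
  assumes "direct_sum_of (carrier M) A B"
  obtains p where "p \<in> mod_hom R (restrict_mod M (carrier M)) M"
    "\<And>x. x \<in> carrier M \<Longrightarrow> p x \<in> B" "\<And>x. x \<in> carrier M \<Longrightarrow> x \<ominus>\<^bsub>M\<^esub> p x \<in> A"
    "\<And>x. x \<in> A \<Longrightarrow> p x = \<zero>\<^bsub>M\<^esub>"
proof -
  note d = direct_sum_ofD[OF assms]
  note A = submoduleD[OF d(1)] and B = submoduleD[OF d(2)]
  have uniq: "b = b'" if "a \<in> A" "a' \<in> A" "b \<in> B" "b' \<in> B" "a \<oplus>\<^bsub>M\<^esub> b = a' \<oplus>\<^bsub>M\<^esub> b'" for a a' b b'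
  proof -
    have c: "a \<in> carrier M" "a' \<in> carrier M" "b \<in> carrier M" "b' \<in> carrier M" using that A(2) B(2) by auto
    \<comment> \<open>Equal sums give b - b' = a' - a, an element of \<open>A \<inter> B\<close>;
      hence components are unique and \<open>p\<close> is well defined.\<close>
    have "b \<ominus>\<^bsub>M\<^esub> b' = \<ominus>\<^bsub>M\<^esub> a \<oplus>\<^bsub>M\<^esub> (a \<oplus>\<^bsub>M\<^esub> b) \<ominus>\<^bsub>M\<^esub> b'" using c by (simp add: M.r_neg1 M.r_neg2 minus_cancel a_minus_def)
    also have "\<dots> = a' \<ominus>\<^bsub>M\<^esub> a"
      using c by (simp add: that(5) a_minus_def M.a_ac M.r_neg M.r_neg1 M.r_neg2 minus_cancel)
    finally have "b \<ominus>\<^bsub>M\<^esub> b' = \<zero>\<^bsub>M\<^esub>"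
      using d(6)[of "b \<ominus>\<^bsub>M\<^esub> b'"] A(6)[OF that(2,1)] B(6)[OF that(3,4)] by simp
    then show ?thesis using c minus_eq_zeroD by blast
  qed
  define p where "p x = (THE b. b \<in> B \<and> (\<exists>a\<in>A. x = a \<oplus>\<^bsub>M\<^esub> b))" for x
  have p: "p (a \<oplus>\<^bsub>M\<^esub> b) = b" if "a \<in> A" "b \<in> B" for a b
    unfolding p_def using that uniq by (intro the_equality) blast+
  show ?thesis
  proof (rule that)
    fix x assume "x \<in> carrier M"
    then obtain a b where ab: "a \<in> A" "b \<in> B" "x = a \<oplus>\<^bsub>M\<^esub> b" using d(7) by blast
    then show "p x \<in> B" using p by simp
    have "x \<ominus>\<^bsub>M\<^esub> p x = a" using ab A(2) B(2) by (simp add: p a_minus_def M.a_assoc M.r_neg)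
    then show "x \<ominus>\<^bsub>M\<^esub> p x \<in> A" using ab by simp
  next
    fix x assume "x \<in> A"
    then show "p x = \<zero>\<^bsub>M\<^esub>" using p[of x "\<zero>\<^bsub>M\<^esub>"] A(2) B(3) by simp
  next
    have "p (x \<oplus>\<^bsub>M\<^esub> y) = p x \<oplus>\<^bsub>M\<^esub> p y" if xy: "x \<in> carrier M" "y \<in> carrier M" for x y
    proof -
      obtain a b where x: "a \<in> A" "b \<in> B" "x = a \<oplus>\<^bsub>M\<^esub> b" using d(7)[OF xy(1)] by blast
      obtain a' b' where y: "a' \<in> A" "b' \<in> B" "y = a' \<oplus>\<^bsub>M\<^esub> b'" using d(7)[OF xy(2)] by blast
      note ab = x y
      then have "x \<oplus>\<^bsub>M\<^esub> y = (a \<oplus>\<^bsub>M\<^esub> a') \<oplus>\<^bsub>M\<^esub> (b \<oplus>\<^bsub>M\<^esub> b')" using A(2) B(2) by (simp add: M.a_ac)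
      then show ?thesis using ab p A(4) B(4) by simp
    qed
    moreover have "p (r \<odot>\<^bsub>M\<^esub> x) = r \<odot>\<^bsub>M\<^esub> p x" if rx: "r \<in> carrier R" "x \<in> carrier M" for r x
    proof -
      obtain a b where ab: "a \<in> A" "b \<in> B" "x = a \<oplus>\<^bsub>M\<^esub> b" using d(7) rx by blast
      then have "r \<odot>\<^bsub>M\<^esub> x = (r \<odot>\<^bsub>M\<^esub> a) \<oplus>\<^bsub>M\<^esub> (r \<odot>\<^bsub>M\<^esub> b)" using A(2) B(2) rx by (simp add: smult_r_distr)
      then show ?thesis using ab p A(7) B(7) rx by simp
    qed
    moreover have "p x \<in> carrier M" if "x \<in> carrier M" for x
      using d(7)[OF that] p B(2) by auto
    ultimately show "p \<in> mod_hom R (restrict_mod M (carrier M)) M" by (auto simp: mod_hom_def)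
  qed
qed

section \<open>Injective endomorphisms of artinian modules, and graphs over a summand\<close>

text \<open>The images of \<open>X\<close> under the powers of \<open>f\<close> form a descending
  chain, which becomes stationary at some \<open>k\<close>. The images of \<open>X\<close> under
  \<open>f ^^ Suc k\<close> and \<open>f ^^ k\<close> then agree, and cancelling the injective map
  \<open>f ^^ k\<close> leaves f(X) = X.\<close>

lemma artinian_inj_surj:
  assumes art: "artinian_module R (restrict_mod M X)" and X: "submodule X R M"
    and f: "f \<in> mod_hom R (restrict_mod M X) M" and fX: "f ` X \<subseteq> X" and inj: "inj_on f X"
  shows "f ` X = X"
proof -
  define S where "S i = (f ^^ i) ` X" for i
  have S_Suc: "S (Suc i) = f ` S i" for i by (simp add: S_def image_comp)
  have S: "submodule (S i) R M \<and> S i \<subseteq> X" for i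
  proof (induction i)
    case (Suc i)
    then have "f \<in> mod_hom R (restrict_mod M (S i)) M" using f hom_restrict_subset by blast
    then have "submodule (S (Suc i)) R M" using Suc submodule_image by (simp add: S_Suc)
    moreover have "S (Suc i) \<subseteq> X" using Suc fX unfolding S_Suc by blast
    ultimately show ?case by blast
  qed (simp add: S_def X)
  have "S (Suc i) \<subseteq> S i" for i
  proof (induction i)
    case (Suc i) then show ?case unfolding S_Suc[of "Suc i"] S_Suc[of i] by blast
  qed (use fX in \<open>simp add: S_def\<close>)
  then obtain k where k: "\<forall>i\<ge>k. S i = S k"
    using art S unfolding artinian_module_def submodule_restrict_iff[OF X] by meson
  have inj_pow: "inj_on (f ^^ i) X" for i
  proof (induction i)
    case (Suc i)
    have "inj_on f ((f ^^ i) ` X)" using S[of i] inj by (simp add: S_def inj_on_subset)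
    then have "inj_on (f \<circ> f ^^ i) X" using Suc by (rule comp_inj_on[rotated])
    then show ?case by (simp add: comp_def)
  qed simp
  \<comment> \<open>The extra \<open>f\<close> is applied first, so that \<open>f ^^ k\<close> is
    the outer map and can be cancelled.\<close>
  have "(f ^^ k) ` (f ` X) = (f ^^ k) ` X"
    using k[rule_format, of "Suc k"] by (simp add: S_def image_comp funpow_Suc_right del: funpow.simps)
  then show ?thesis using inj_on_image_eq_iff[OF inj_pow fX order_refl] by simp
qed

text \<open>The graph of the composition of the isomorphism \<open>g\<close> with the projection along \<open>X\<close> onto a
  complement of \<open>X\<close> is again a summand isomorphic to \<open>X\<close>, and it has the same sum with \<open>X\<close> as \<open>N\<close>.\<close>

lemma disjoint_iso_graph:
  assumes X: "direct_summand X R M" and N: "submodule N R M" and XN: "X \<inter> N = {\<zero>\<^bsub>M\<^esub>}"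
    and iso: "mod_isomorphic R (restrict_mod M X) (restrict_mod M N)"
  obtains G where "direct_summand G R M" "X \<inter> G = {\<zero>\<^bsub>M\<^esub>}" "X <+>\<^bsub>M\<^esub> G = X <+>\<^bsub>M\<^esub> N"
    "mod_isomorphic R (restrict_mod M X) (restrict_mod M G)"
proof -
  obtain Y where XY: "direct_sum_of (carrier M) X Y" using X by (auto simp: direct_summand_iff)
  note d = direct_sum_ofD[OF XY]
  note x = submoduleD[OF d(1)] and y = submoduleD[OF d(2)] and n = submoduleD[OF N]
  obtain g where g: "g \<in> mod_hom R (restrict_mod M X) M" and bij: "bij_betw g X N"
    using iso mod_isomorphic_restrict_iff[OF N] by blast
  have gX: "g ` X = N" using bij by (simp add: bij_betw_def)
  obtain p where p: "p \<in> mod_hom R (restrict_mod M (carrier M)) M"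
    "\<And>x. x \<in> carrier M \<Longrightarrow> p x \<in> Y" "\<And>x. x \<in> carrier M \<Longrightarrow> x \<ominus>\<^bsub>M\<^esub> p x \<in> X"
    by (rule projection[OF XY]) (rule that)
  note gh = hom_restrictD[OF g] and ph = hom_restrictD[OF p(1)]
  \<comment> \<open>The component of \<open>f u\<close> in \<open>X\<close> is \<open>u\<close>, and
    its component in \<open>Y\<close> is that of \<open>g u\<close>; the image of \<open>f\<close>
    is thus the graph of the map \<open>p \<circ> g\<close> from \<open>X\<close> to
    \<open>Y\<close>.\<close>
  define f where "f u = u \<oplus>\<^bsub>M\<^esub> p (g u)" for u
  have pg: "p (g u) \<in> Y" "p (g u) \<in> carrier M" if "u \<in> X" for u
    using p(2) gh(1) that y(2) by auto
  have "f (u \<oplus>\<^bsub>M\<^esub> v) = f u \<oplus>\<^bsub>M\<^esub> f v" if "u \<in> X" "v \<in> X" for u v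
    using that pg(2)[OF that(1)] pg(2)[OF that(2)] x(2)[OF that(1)] x(2)[OF that(2)] gh(1)
    by (simp add: f_def gh(2) ph(2) M.a_ac)
  moreover have "f (r \<odot>\<^bsub>M\<^esub> u) = r \<odot>\<^bsub>M\<^esub> f u" if "r \<in> carrier R" "u \<in> X" for r u
    using that pg(2)[OF that(2)] x(2)[OF that(2)] gh(1) by (simp add: f_def gh(3) ph(3) smult_r_distr)
  ultimately have f: "f \<in> mod_hom R (restrict_mod M X) M"
    using pg(2) x(2) by (auto simp: mod_hom_def f_def)
  define G where "G = f ` X"
  have G: "submodule G R M" unfolding G_def using submodule_image[OF f d(1)] .
  \<comment> \<open>The graph meets \<open>Y\<close> only in zero, because \<open>u\<close> is
    recovered from \<open>f u\<close> by subtracting an element of \<open>Y\<close>. This also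
    yields the injectivity of \<open>f\<close>.\<close>
  have GY: "u = \<zero>\<^bsub>M\<^esub>" if "u \<in> X" "f u \<in> Y" for u
  proof -
    have "u = f u \<ominus>\<^bsub>M\<^esub> p (g u)"
      using that pg(2)[of u] x(2)[of u] by (simp add: f_def a_minus_def M.a_assoc M.r_neg)
    also have "\<dots> \<in> Y" using y(6)[OF that(2) pg(1)[OF that(1)]] .
    finally show ?thesis using d(6)[OF that(1)] by simp
  qed
  have f0: "f \<zero>\<^bsub>M\<^esub> = \<zero>\<^bsub>M\<^esub>" using hom_restrict_zero_minus(1)[OF f d(1)] .
  have inj: "inj_on f X"
    by (rule hom_restrict_injI[OF f d(1)]) (simp add: GY y(3))
  show ?thesis
  proof (rule that)
    have "direct_sum_of (carrier M) G Y"
    proof (rule direct_sum_ofI)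
      show "c = \<zero>\<^bsub>M\<^esub>" if "c \<in> G" "c \<in> Y" for c using that GY f0 unfolding G_def by force
      show "\<exists>a\<in>G. \<exists>b\<in>Y. c = a \<oplus>\<^bsub>M\<^esub> b" if c: "c \<in> carrier M" for c
      proof -
        obtain u v where uv: "u \<in> X" "v \<in> Y" "c = u \<oplus>\<^bsub>M\<^esub> v" using d(7)[OF c] by blast
        \<comment> \<open>Passing from \<open>u\<close> to the graph point \<open>f u\<close> is
          compensated inside \<open>Y\<close>, so \<open>Y\<close> is a complement of
          \<open>G\<close> as well as of \<open>X\<close>.\<close>
        then have "c = f u \<oplus>\<^bsub>M\<^esub> (v \<ominus>\<^bsub>M\<^esub> p (g u))"
          using pg(2)[of u] x(2)[of u] y(2)[of v]
          by (simp add: f_def a_minus_def M.a_ac M.r_neg M.r_neg1 M.r_neg2 minus_cancel)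
        moreover have "v \<ominus>\<^bsub>M\<^esub> p (g u) \<in> Y" using y(6)[OF uv(2) pg(1)[OF uv(1)]] .
        ultimately show ?thesis using uv(1) unfolding G_def by blast
      qed
    qed (use G d(2,3,5) submoduleD(1)[OF G] in auto)
    then show "direct_summand G R M" by (auto simp: direct_summand_iff)
    show "mod_isomorphic R (restrict_mod M X) (restrict_mod M G)"
      unfolding G_def by (rule mod_isomorphic_image[OF f d(1) inj])
    have "u = \<zero>\<^bsub>M\<^esub>" if u: "u \<in> X" "u \<in> G" for u
    proof -
      obtain v where v: "v \<in> X" "u = f v" using u(2) unfolding G_def by blast
      \<comment> \<open>If \<open>f v\<close> lies in \<open>X\<close>, its component in
        \<open>Y\<close> vanishes, so \<open>g v\<close> itself lies in \<open>X \<inter> N\<close>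
        and is zero. Injectivity of \<open>g\<close> then gives \<open>v\<close> zero.\<close>
      then have "p (g v) = u \<ominus>\<^bsub>M\<^esub> v"
        using pg(2)[of v] x(2)[of v] by (simp add: f_def a_minus_def M.a_ac M.r_neg1 M.r_neg2 minus_cancel)
      then have pg0: "p (g v) = \<zero>\<^bsub>M\<^esub>"
        using d(6)[of "p (g v)"] pg(1)[OF v(1)] x(6)[OF u(1) v(1)] by simp
      have "g v \<ominus>\<^bsub>M\<^esub> p (g v) \<in> X" using p(3)[OF gh(1)[OF v(1)]] .
      then have "g v \<in> X \<inter> N"
        using v(1) gX by (auto simp: pg0 minus_zero_right[OF gh(1)[OF v(1)]])
      then have "g v = g \<zero>\<^bsub>M\<^esub>"
        using XN hom_restrict_zero_minus(1)[OF g d(1)] by simp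
      then have "v = \<zero>\<^bsub>M\<^esub>" using bij v(1) x(3) unfolding bij_betw_def by (blast dest: inj_onD)
      then show ?thesis using v f0 by simp
    qed
    then show "X \<inter> G = {\<zero>\<^bsub>M\<^esub>}" using x(3) submoduleD(3)[OF G] by blast
    \<comment> \<open>For each \<open>u\<close>, the points \<open>g u\<close> of \<open>N\<close>
      and \<open>f u\<close> of \<open>G\<close> differ by an element of \<open>X\<close>; this is
      why both submodules have the same sum with \<open>X\<close>.\<close>
    have diff: "\<exists>w\<in>X. g u = w \<oplus>\<^bsub>M\<^esub> f u \<and> f u = \<ominus>\<^bsub>M\<^esub> w \<oplus>\<^bsub>M\<^esub> g u" if u: "u \<in> X" for u
    proof
      let ?w = "(g u \<ominus>\<^bsub>M\<^esub> p (g u)) \<ominus>\<^bsub>M\<^esub> u"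
      show "?w \<in> X" using x(6)[OF p(3)[OF gh(1)[OF u]] u] .
      have c: "u \<in> carrier M" "g u \<in> carrier M" "p (g u) \<in> carrier M" using u x(2) gh(1) pg(2) by auto
      then show "g u = ?w \<oplus>\<^bsub>M\<^esub> f u \<and> f u = \<ominus>\<^bsub>M\<^esub> ?w \<oplus>\<^bsub>M\<^esub> g u"
        by (simp add: f_def a_minus_def M.a_ac M.r_neg1 M.r_neg2 minus_cancel M.minus_add M.r_neg M.l_neg)
    qed
    show "X <+>\<^bsub>M\<^esub> G = X <+>\<^bsub>M\<^esub> N"
    proof
      have "G \<subseteq> X <+>\<^bsub>M\<^esub> N"
      proof
        fix z assume "z \<in> G"
        then obtain u where "u \<in> X" "z = f u" by (auto simp: G_def)
        moreover obtain w where "w \<in> X" "f u = \<ominus>\<^bsub>M\<^esub> w \<oplus>\<^bsub>M\<^esub> g u" using diff[OF calculation(1)] by blast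
        moreover have "g u \<in> N" using calculation(1) gX by blast
        ultimately show "z \<in> X <+>\<^bsub>M\<^esub> N" using x(5)[of w] unfolding set_add_iff by metis
      qed
      then show "X <+>\<^bsub>M\<^esub> G \<subseteq> X <+>\<^bsub>M\<^esub> N"
        using set_add_memI(1)[OF d(1) N] by (intro set_add_subsetI submodule_set_add d(1) N) auto
      have "N \<subseteq> X <+>\<^bsub>M\<^esub> G"
      proof
        fix z assume "z \<in> N"
        then obtain u where "u \<in> X" "z = g u" using gX by blast
        moreover obtain w where "w \<in> X" "g u = w \<oplus>\<^bsub>M\<^esub> f u" using diff[OF calculation(1)] by blast
        moreover have "f u \<in> G" using calculation(1) by (simp add: G_def)
        ultimately show "z \<in> X <+>\<^bsub>M\<^esub> G" unfolding set_add_iff by metis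
      qed
      then show "X <+>\<^bsub>M\<^esub> N \<subseteq> X <+>\<^bsub>M\<^esub> G"
        using set_add_memI(1)[OF d(1) G] by (intro set_add_subsetI submodule_set_add d(1) G) auto
    qed
  qed
qed

section \<open>Finite sums of submodules\<close>

lemma submodule_sum_0: "submodule_sum M 0 X = {\<zero>\<^bsub>M\<^esub>}"
  by (auto simp: submodule_sum_def)

lemma submodule_sum_Suc:
  assumes X: "\<And>i. i \<in> {1..Suc n} \<Longrightarrow> X i \<subseteq> carrier M"
  shows "submodule_sum M (Suc n) X = submodule_sum M n X <+>\<^bsub>M\<^esub> X (Suc n)"
proof -
  have ins: "{1..Suc n} = insert (Suc n) {1..n}" by auto
  have step: "(\<Oplus>\<^bsub>M\<^esub>i\<in>{1..Suc n}. x i) = (\<Oplus>\<^bsub>M\<^esub>i\<in>{1..n}. x i) \<oplus>\<^bsub>M\<^esub> x (Suc n)"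
    if x: "\<forall>i\<in>{1..Suc n}. x i \<in> X i" for x
  proof -
    have "x i \<in> carrier M" if "i \<in> {1..Suc n}" for i using x X that by blast
    then have "x \<in> {1..n} \<rightarrow> carrier M" "x (Suc n) \<in> carrier M" by auto
    then show ?thesis unfolding ins by (subst M.finsum_insert) (auto intro: M.a_comm)
  qed
  show ?thesis
  proof (intro equalityI subsetI)
    fix z assume "z \<in> submodule_sum M (Suc n) X"
    then obtain x where x: "\<forall>i\<in>{1..Suc n}. x i \<in> X i" "z = (\<Oplus>\<^bsub>M\<^esub>i\<in>{1..Suc n}. x i)"
      by (auto simp: submodule_sum_def)
    then show "z \<in> submodule_sum M n X <+>\<^bsub>M\<^esub> X (Suc n)"
      unfolding set_add_iff submodule_sum_def using step[OF x(1)] by fastforce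
  next
    fix z assume "z \<in> submodule_sum M n X <+>\<^bsub>M\<^esub> X (Suc n)"
    then obtain x b where x: "\<forall>i\<in>{1..n}. x i \<in> X i" "b \<in> X (Suc n)"
      "z = (\<Oplus>\<^bsub>M\<^esub>i\<in>{1..n}. x i) \<oplus>\<^bsub>M\<^esub> b"
      by (auto simp: submodule_sum_def set_add_iff)
    \<comment> \<open>A representing family for the shorter sum is extended by \<open>b\<close> at
      the new index; its values on \<open>{1..n}\<close> do not change.\<close>
    let ?x = "x(Suc n := b)"
    have x': "\<forall>i\<in>{1..Suc n}. ?x i \<in> X i" using x by (auto simp: le_Suc_eq)
    have "x i \<in> carrier M" if "i \<in> {1..n}" for i using x(1) X[of i] that by auto
    then have "(\<Oplus>\<^bsub>M\<^esub>i\<in>{1..n}. ?x i) = (\<Oplus>\<^bsub>M\<^esub>i\<in>{1..n}. x i)"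
      by (intro M.finsum_cong') auto
    then have "z = (\<Oplus>\<^bsub>M\<^esub>i\<in>{1..Suc n}. ?x i)" using step[OF x'] x(3) by simp
    then show "z \<in> submodule_sum M (Suc n) X" using x' unfolding submodule_sum_def by blast
  qed
qed

end

section \<open>The class of artinian modules and the splitting of homomorphisms\<close>

locale projective_class = right_module R M
  for R :: "('r, 'c) ring_scheme" (structure) and M :: "('r, 'm) module" (structure) +
  fixes \<A> :: "('r, 'm) module set"
  assumes artinian: "K \<in> \<A> \<Longrightarrow> artinian_module R K"
    and closed_iso: "closed_under_iso R \<A>"
    and closed_summands: "closed_under_summands R \<A>"
    and projective: "submodule N R M \<Longrightarrow> class_projective R \<A> (restrict_mod M N)"
begin

lemma iso_in_class:
  assumes "restrict_mod M P \<in> \<A>" "submodule Q R M"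
    and "mod_isomorphic R (restrict_mod M P) (restrict_mod M Q)"
  shows "restrict_mod M Q \<in> \<A>"
  using closed_iso assms right_module_restrict unfolding closed_under_iso_def by blast

lemma summand_in_class:
  assumes "restrict_mod M P \<in> \<A>" "direct_sum_of P A B"
  shows "restrict_mod M A \<in> \<A>"
proof -
  have "direct_summand A R (restrict_mod M P)"
    using assms(2) direct_sum_ofD(3) direct_summand_restrict_iff by blast
  \<comment> \<open>Restricting twice gives the same record as restricting to \<open>A\<close> at
    once, by which \<open>simp\<close> concludes.\<close>
  then have "restrict_mod (restrict_mod M P) A \<in> \<A>"
    using closed_summands assms(1) unfolding closed_under_summands_def by blast
  then show ?thesis by simp
qed

text \<open>The image of \<open>f\<close> is a submodule of \<open>M\<close> and hence projective
  relative to \<open>P\<close>. Its identity map therefore lifts through \<open>f\<close> to a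
  section \<open>s\<close>, and the image of \<open>s\<close> is a complement \<open>Q\<close> of
  the kernel.\<close>

lemma kernel_splits:
  assumes PA: "restrict_mod M P \<in> \<A>" and P: "submodule P R M"
    and f: "f \<in> mod_hom R (restrict_mod M P) M"
  obtains Q where "direct_sum_of P {x \<in> P. f x = \<zero>\<^bsub>M\<^esub>} Q" "inj_on f Q" "f ` Q = f ` P"
proof -
  let ?K = "restrict_mod M (f ` P)"
  have fP: "submodule (f ` P) R M" using submodule_image[OF f P] .
  note h = hom_restrictD[OF f] and p = submoduleD[OF P]
  have "f \<in> mod_epi R (restrict_mod M P) ?K"
    using f by (auto simp: mod_epi_def mod_hom_def)
  moreover have "(\<lambda>y. y) \<in> mod_hom R ?K ?K" by (auto simp: mod_hom_def)
  moreover have "rel_projective R (restrict_mod M P) ?K"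
    using projective[OF fP] PA by (simp add: class_projective_def)
  ultimately obtain s where s: "s \<in> mod_hom R ?K (restrict_mod M P)"
    and fs: "\<And>y. y \<in> f ` P \<Longrightarrow> f (s y) = y"
    using right_module_restrict[OF fP] unfolding rel_projective_def by fastforce
  have sP: "s y \<in> P" if "y \<in> f ` P" for y using s that by (auto simp: mod_hom_def)
  have s': "s \<in> mod_hom R ?K M" using s p(2) by (auto simp: mod_hom_def)
  let ?Q = "s ` f ` P"
  show ?thesis
  proof (rule that)
    show "direct_sum_of P {x \<in> P. f x = \<zero>\<^bsub>M\<^esub>} ?Q"
    proof (rule direct_sum_ofI)
      show "submodule {x \<in> P. f x = \<zero>\<^bsub>M\<^esub>} R M" using submodule_kernel[OF f P] .
      show "submodule ?Q R M" using submodule_image[OF s' fP] .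
    next
      fix x assume "x \<in> {x \<in> P. f x = \<zero>\<^bsub>M\<^esub>}" "x \<in> ?Q"
      then obtain y where "y \<in> f ` P" "x = s y" "f x = \<zero>\<^bsub>M\<^esub>" by blast
      then show "x = \<zero>\<^bsub>M\<^esub>" using fs hom_restrict_zero_minus(1)[OF s' fP] by metis
    next
      fix c assume c: "c \<in> P"
      \<comment> \<open>The component in the complement is the section applied to
        \<open>f c\<close>; what remains is killed by \<open>f\<close>.\<close>
      let ?b = "s (f c)"
      have b: "?b \<in> P" using sP c by blast
      have "f (c \<ominus>\<^bsub>M\<^esub> ?b) = \<zero>\<^bsub>M\<^esub>"
        unfolding hom_restrict_zero_minus(3)[OF f P c b] using c fs h(1) by (simp add: a_minus_def M.r_neg)
      moreover have "c \<ominus>\<^bsub>M\<^esub> ?b \<in> P" using c b p(6) by blast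
      moreover have "c = (c \<ominus>\<^bsub>M\<^esub> ?b) \<oplus>\<^bsub>M\<^esub> ?b"
        using c b p(2) by (simp add: a_minus_def M.a_assoc M.l_neg)
      ultimately show "\<exists>a\<in>{x \<in> P. f x = \<zero>\<^bsub>M\<^esub>}. \<exists>b\<in>?Q. c = a \<oplus>\<^bsub>M\<^esub> b" using c by blast
    qed (use P sP in auto)
    show "inj_on f ?Q" using fs by (auto intro!: inj_onI)
    show "f ` ?Q = f ` P" using fs by (force simp: image_iff)
  qed
qed

text \<open>Like \<open>summand_sums\<close> below, this has the literal form of the condition in
  the theorem, so that unfolding the two names recovers its statement.\<close>

definition C2 :: bool where
  "C2 \<longleftrightarrow> (\<forall>N. submodule N R M \<and> restrict_mod M N \<in> \<A> \<and>
     (\<exists>X. direct_summand X R M \<and> mod_isomorphic R (restrict_mod M N) (restrict_mod M X))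
     \<longrightarrow> direct_summand N R M)"

definition summand_sums :: bool where
  "summand_sums \<longleftrightarrow> (\<forall>n\<ge>1. \<forall>X :: nat \<Rightarrow> 'm set.
     (\<forall>i\<in>{1..n}. direct_summand (X i) R M \<and> restrict_mod M (X i) \<in> \<A>)
     \<longrightarrow> direct_summand (submodule_sum M n X) R M)"

section \<open>From (1) to (2)\<close>

text \<open>C3 cannot be applied to \<open>X\<close> and \<open>N\<close> directly, since
  \<open>N\<close> is not yet known to be a summand. The graph \<open>G\<close> is one and has the
  same sum with \<open>X\<close>, so C3 for \<open>X\<close> and \<open>G\<close> makes the direct
  sum of \<open>X\<close> and \<open>N\<close> a summand, and with it \<open>N\<close>.\<close>

lemma C3_disjoint_iso:
  assumes C3: "class_C3 R \<A> M" and X: "direct_summand X R M" and XA: "restrict_mod M X \<in> \<A>"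
    and N: "submodule N R M" and XN: "X \<inter> N = {\<zero>\<^bsub>M\<^esub>}"
    and iso: "mod_isomorphic R (restrict_mod M X) (restrict_mod M N)"
  shows "direct_summand N R M"
proof -
  obtain G where G: "direct_summand G R M" "X \<inter> G = {\<zero>\<^bsub>M\<^esub>}" "X <+>\<^bsub>M\<^esub> G = X <+>\<^bsub>M\<^esub> N"
    "mod_isomorphic R (restrict_mod M X) (restrict_mod M G)"
    using disjoint_iso_graph[OF X N XN iso] by blast
  have "restrict_mod M G \<in> \<A>"
    using iso_in_class[OF XA _ G(4)] G(1) by (auto simp: direct_summand_def)
  then have "direct_summand (X <+>\<^bsub>M\<^esub> N) R M"
    using C3 X XA G unfolding class_C3_def by metis
  moreover have "direct_sum_of (X <+>\<^bsub>M\<^esub> N) X N"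
    using X N XN by (simp add: direct_sum_of_def direct_summand_def)
  ultimately show ?thesis using direct_summand_trans direct_sum_of_commute by blast
qed

lemma C3_iso_summand:
  assumes C3: "class_C3 R \<A> M"
    and "direct_summand X R M" "restrict_mod M X \<in> \<A>"
    and "submodule N R M" "mod_isomorphic R (restrict_mod M N) (restrict_mod M X)"
  shows "direct_summand N R M"
proof -
  \<comment> \<open>The larger module of each pair is required to lie in the class: this makes it
    artinian, and an infinite descending chain would lie inside its first member.\<close>
  define r where "r = {(U, V). submodule U R M \<and> submodule V R M \<and> U \<subset> V \<and> restrict_mod M V \<in> \<A>}"
  have "wf r"
  proof (rule ccontr)
    assume "\<not> wf r"
    then obtain S where S: "\<And>i. (S (Suc i), S i) \<in> r" unfolding wf_iff_no_infinite_down_chain by blast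
    have sub: "submodule (S i) R M" and less: "S (Suc i) \<subset> S i" for i
      using S[of i] by (auto simp: r_def)
    have "artinian_module R (restrict_mod M (S 0))" using S[of 0] artinian by (auto simp: r_def)
    moreover have "S i \<subseteq> S 0" for i
    proof (induction i)
      case (Suc i) then show ?case using less[of i] by blast
    qed simp
    then have "submodule (S i) R (restrict_mod M (S 0)) \<and> S (Suc i) \<subseteq> S i" for i
      using sub less[of i] by (simp add: submodule_restrict_iff[OF sub] psubset_imp_subset)
    ultimately obtain k where k: "\<forall>i\<ge>k. S i = S k"
      unfolding artinian_module_def by meson
    have "S (Suc k) = S k" by (rule k[rule_format]) simp
    then show False using less[of k] by simp
  qed
  then show ?thesis using assms(2-)
  \<comment> \<open>The induction is on the target summand \<open>X\<close>. The source
    \<open>N\<close> must vary, because the hypothesis is applied to \<open>D\<close> and its image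
    under \<open>f\<close>.\<close>
  proof (induction X arbitrary: N rule: wf_induct_rule)
    case (less X)
    have Xs: "submodule X R M" using less.prems by (simp add: direct_summand_def)
    note N = \<open>submodule N R M\<close>
    have NA: "restrict_mod M N \<in> \<A>"
      using iso_in_class[OF less.prems(2) N] mod_isomorphic_sym[OF N Xs] less.prems(4) by blast
    obtain f where f: "f \<in> mod_hom R (restrict_mod M N) M" and bij: "bij_betw f N X"
      using less.prems(4) mod_isomorphic_restrict_iff[OF Xs] by blast
    have inj: "inj_on f N" and fN: "f ` N = X" using bij by (auto simp: bij_betw_def)
    obtain Y where XY: "direct_sum_of (carrier M) X Y"
      using less.prems by (auto simp: direct_summand_iff)
    obtain p where p: "p \<in> mod_hom R (restrict_mod M (carrier M)) M"
      "\<And>x. x \<in> carrier M \<Longrightarrow> x \<ominus>\<^bsub>M\<^esub> p x \<in> X" "\<And>x. x \<in> X \<Longrightarrow> p x = \<zero>\<^bsub>M\<^esub>"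
      by (rule projection[OF XY]) (rule that)
    have pN: "p \<in> mod_hom R (restrict_mod M N) M"
      using p(1) submoduleD(1)[OF N] hom_restrict_subset by blast
    define D where "D = {x \<in> N. p x = \<zero>\<^bsub>M\<^esub>}"
    \<comment> \<open>An element with \<open>p x\<close> zero equals its own component in
      \<open>X\<close>.\<close>
    have D: "D = N \<inter> X"
    proof -
      have "x \<in> X" if "x \<in> N" "p x = \<zero>\<^bsub>M\<^esub>" for x
        using p(2)[of x] that submoduleD(2)[OF N that(1)] by (simp add: minus_zero_right)
      then show ?thesis using p(3) by (auto simp: D_def)
    qed
    obtain N' where DN': "direct_sum_of N D N'"
      by (rule kernel_splits[OF NA N pN, folded D_def]) (rule that)
    note d = direct_sum_ofD[OF DN']
    have DA: "restrict_mod M D \<in> \<A>" using summand_in_class[OF NA DN'] .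
    have N'A: "restrict_mod M N' \<in> \<A>"
      using summand_in_class[OF NA direct_sum_of_commute[OF DN']] .
    have fD: "f \<in> mod_hom R (restrict_mod M D) M" "inj_on f D"
      and fN': "f \<in> mod_hom R (restrict_mod M N') M" "inj_on f N'"
      using f inj d(4,5) hom_restrict_subset by (auto intro: inj_on_subset)
    have sum: "direct_sum_of X (f ` D) (f ` N')" using direct_sum_of_image[OF f inj DN'] fN by simp
    note e = direct_sum_ofD[OF sum]
    have isoD: "mod_isomorphic R (restrict_mod M D) (restrict_mod M (f ` D))"
      using mod_isomorphic_image[OF fD(1) d(1) fD(2)] .
    have isoN': "mod_isomorphic R (restrict_mod M (f ` N')) (restrict_mod M N')"
      using mod_isomorphic_sym[OF d(2) e(2)] mod_isomorphic_image[OF fN'(1) d(2) fN'(2)] by blast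
    have N'_summand: "direct_summand N' R M"
    proof (rule C3_disjoint_iso[OF C3 _ _ d(2) _ isoN'])
      show "direct_summand (f ` N') R M"
        using direct_summand_trans[OF less.prems(1) direct_sum_of_commute[OF sum]] .
      show "restrict_mod M (f ` N') \<in> \<A>"
        using summand_in_class[OF less.prems(2) direct_sum_of_commute[OF sum]] .
      \<comment> \<open>Such an element lies in \<open>N \<inter> X\<close>, which is
        \<open>D\<close>, while \<open>D\<close> and \<open>N'\<close> meet only in zero.\<close>
      have "u = \<zero>\<^bsub>M\<^esub>" if "u \<in> f ` N'" "u \<in> N'" for u
      proof -
        have "u \<in> D" using that e(5) d(5) unfolding D by blast
        then show ?thesis using d(6)[of u] that(2) by simp
      qed
      then show "f ` N' \<inter> N' = {\<zero>\<^bsub>M\<^esub>}" using submoduleD(3)[OF d(2)] submoduleD(3)[OF e(2)] by blast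
    qed
    show ?case
    proof (cases "f ` D = X")
      case True
      then have "D = N" using inj_on_image_eq_iff[OF inj d(4) order_refl] fN by simp
      then have NX: "N \<subseteq> X" using D by blast
      \<comment> \<open>Since \<open>N\<close> is now contained in \<open>X\<close>, the inverse of
        \<open>f\<close> is an injective endomorphism of \<open>X\<close> with image
        \<open>N\<close>.\<close>
      define g where "g = inv_into N f"
      have g: "g \<in> mod_hom R (restrict_mod M X) M" "bij_betw g X N"
        using hom_restrict_inverse[OF f N bij] by (simp_all add: g_def)
      then have "g ` X = X"
        using NX by (intro artinian_inj_surj[OF artinian[OF less.prems(2)] Xs])
          (auto simp: bij_betw_def)
      then have "N = X" using g by (simp add: bij_betw_def)
      then show ?thesis using less.prems by simp
    next
      case False
      \<comment> \<open>The image of \<open>D\<close> under \<open>f\<close> is a summand of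
        \<open>X\<close>, hence of \<open>M\<close>, and is properly contained in \<open>X\<close>;
        it takes the place of \<open>X\<close> in the induction hypothesis.\<close>
      have "direct_summand D R M"
      proof (rule less.IH)
        show "(f ` D, X) \<in> r" using False e(1,4) Xs less.prems(2) by (auto simp: r_def)
        show "direct_summand (f ` D) R M" using direct_summand_trans[OF less.prems(1) sum] .
        show "restrict_mod M (f ` D) \<in> \<A>" using summand_in_class[OF less.prems(2) sum] .
      qed (fact d(1), fact isoD)
      then have "direct_summand (D <+>\<^bsub>M\<^esub> N') R M"
        using C3 N'_summand DA N'A DN' unfolding class_C3_def direct_sum_of_def by blast
      then show ?thesis using DN' by (simp add: direct_sum_of_def)
    qed
  qed
qed

lemma C3_imp_C2: "class_C3 R \<A> M \<Longrightarrow> C2"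
  unfolding C2_def
proof (intro allI impI, elim conjE exE)
  fix N X
  assume C3: "class_C3 R \<A> M" and N: "submodule N R M" "restrict_mod M N \<in> \<A>"
    and X: "direct_summand X R M" and iso: "mod_isomorphic R (restrict_mod M N) (restrict_mod M X)"
  have "restrict_mod M X \<in> \<A>"
    using iso_in_class[OF N(2) _ iso] X by (simp add: direct_summand_def)
  then show "direct_summand N R M" using C3_iso_summand[OF C3 X _ N(1) iso] by blast
qed

section \<open>From (2) to (3)\<close>

text \<open>Modulo \<open>S\<close>, the summand \<open>X\<close> may be replaced by its projection to a complement \<open>T\<close> of \<open>S\<close>,
  which is isomorphic to a summand of \<open>X\<close> by projectivity.\<close>

lemma C2_add_summand:
  assumes C2: C2 and S: "direct_summand S R M" and X: "direct_summand X R M"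
    and XA: "restrict_mod M X \<in> \<A>"
  shows "direct_summand (S <+>\<^bsub>M\<^esub> X) R M"
proof -
  obtain T where ST: "direct_sum_of (carrier M) S T" using S by (auto simp: direct_summand_iff)
  note st = direct_sum_ofD[OF ST]
  have Xs: "submodule X R M" using X by (simp add: direct_summand_def)
  note s = submoduleD[OF st(1)] and x = submoduleD[OF Xs]
  obtain p where p: "p \<in> mod_hom R (restrict_mod M (carrier M)) M"
    "\<And>x. x \<in> carrier M \<Longrightarrow> p x \<in> T" "\<And>x. x \<in> carrier M \<Longrightarrow> x \<ominus>\<^bsub>M\<^esub> p x \<in> S"
    by (rule projection[OF ST]) (rule that)
  have pX: "p \<in> mod_hom R (restrict_mod M X) M" using p(1) x(1) hom_restrict_subset by blast
  have C: "submodule (p ` X) R M" using submodule_image[OF pX Xs] .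
  obtain Q where Q: "direct_sum_of X {u \<in> X. p u = \<zero>\<^bsub>M\<^esub>} Q" "inj_on p Q" "p ` Q = p ` X"
    by (rule kernel_splits[OF XA Xs pX])
  note Q' = direct_sum_of_commute[OF Q(1)]
  note q = direct_sum_ofD[OF Q']
  have pQ: "p \<in> mod_hom R (restrict_mod M Q) M" using pX q(4) hom_restrict_subset by blast
  have iso: "mod_isomorphic R (restrict_mod M Q) (restrict_mod M (p ` X))"
    using mod_isomorphic_image[OF pQ q(1) Q(2)] Q(3) by simp
  \<comment> \<open>The image of \<open>X\<close> under \<open>p\<close> is isomorphic to
    \<open>Q\<close>, a summand of \<open>X\<close> and hence of \<open>M\<close>; thus it lies in
    the class and (2) applies to it.\<close>
  have "direct_summand (p ` X) R M"
    using C2 C iso_in_class[OF summand_in_class[OF XA Q'] C iso]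
      direct_summand_trans[OF X Q'] mod_isomorphic_sym[OF q(1) C iso]
    unfolding C2_def by blast
  moreover have "p ` X \<subseteq> T" using p(2) x(2) by blast
  \<comment> \<open>A summand of \<open>M\<close> contained in \<open>T\<close> splits off from
    \<open>T\<close>, which allows it to be added to \<open>S\<close>.\<close>
  ultimately obtain T' where "direct_sum_of T (p ` X) T'" using direct_summand_within st(2) by blast
  then have "direct_summand (S <+>\<^bsub>M\<^esub> p ` X) R M" using direct_summand_add[OF ST] by blast
  moreover have "S <+>\<^bsub>M\<^esub> p ` X = S <+>\<^bsub>M\<^esub> X"
  proof
    have c: "u \<in> carrier M" "p u \<in> carrier M" if "u \<in> X" for u
      using that x(2) hom_restrictD(1)[OF pX] by auto
    \<comment> \<open>Each \<open>u\<close> differs from \<open>p u\<close> by an element of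
      \<open>S\<close>, so replacing \<open>X\<close> by its projection leaves the sum with
      \<open>S\<close> unchanged.\<close>
    have "p u \<in> S <+>\<^bsub>M\<^esub> X" if "u \<in> X" for u
    proof -
      have "p u = \<ominus>\<^bsub>M\<^esub> (u \<ominus>\<^bsub>M\<^esub> p u) \<oplus>\<^bsub>M\<^esub> u"
        using c[OF that] by (simp add: a_minus_def M.a_ac M.r_neg1 M.r_neg2 minus_cancel M.minus_add)
      moreover have "\<ominus>\<^bsub>M\<^esub> (u \<ominus>\<^bsub>M\<^esub> p u) \<in> S" using s(5)[OF p(3)[OF c(1)[OF that]]] .
      ultimately show ?thesis using that unfolding set_add_iff by blast
    qed
    then show "S <+>\<^bsub>M\<^esub> p ` X \<subseteq> S <+>\<^bsub>M\<^esub> X"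
      using set_add_memI(1)[OF st(1) Xs] by (intro set_add_subsetI submodule_set_add st(1) Xs) auto
    have "u \<in> S <+>\<^bsub>M\<^esub> p ` X" if "u \<in> X" for u
    proof -
      have "u = (u \<ominus>\<^bsub>M\<^esub> p u) \<oplus>\<^bsub>M\<^esub> p u"
        using c[OF that] by (simp add: a_minus_def M.a_assoc M.l_neg)
      then show ?thesis using p(3)[OF c(1)[OF that]] that unfolding set_add_iff by blast
    qed
    then show "S <+>\<^bsub>M\<^esub> X \<subseteq> S <+>\<^bsub>M\<^esub> p ` X"
      using set_add_memI(1)[OF st(1) C] by (intro set_add_subsetI submodule_set_add st(1) C) auto
  qed
  ultimately show ?thesis by simp
qed

lemma C2_imp_summand_sums:
  assumes C2 shows summand_sums
proof -
  have "direct_summand (submodule_sum M n X) R M"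
    if "\<forall>i\<in>{1..n}. direct_summand (X i) R M \<and> restrict_mod M (X i) \<in> \<A>" for n X
    using that
  proof (induction n)
    case 0
    \<comment> \<open>The induction starts from the empty sum, which has \<open>M\<close> itself as
      complement, so that a single summand is an ordinary induction step.\<close>
    have "direct_sum_of (carrier M) {\<zero>\<^bsub>M\<^esub>} (carrier M)"
      by (rule direct_sum_ofI) (auto simp: submodule_zero submodule_carrier)
    then show ?case by (auto simp: submodule_sum_0 direct_summand_iff)
  next
    case (Suc n)
    then have "X i \<subseteq> carrier M" if "i \<in> {1..Suc n}" for i
      using that submoduleD(1) unfolding direct_summand_def by blast
    then have "submodule_sum M (Suc n) X = submodule_sum M n X <+>\<^bsub>M\<^esub> X (Suc n)"
      by (rule submodule_sum_Suc)
    then show ?case using C2_add_summand[OF assms] Suc by simp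
  qed
  then show ?thesis by (simp add: summand_sums_def)
qed

section \<open>From (3) to (1), and the equivalence\<close>

lemma summand_sums_imp_C3:
  assumes summand_sums shows "class_C3 R \<A> M"
  unfolding class_C3_def
proof (intro allI impI, elim conjE)
  fix A B
  assume AB: "restrict_mod M A \<in> \<A>" "restrict_mod M B \<in> \<A>"
    "direct_summand A R M" "direct_summand B R M"
  let ?X = "\<lambda>i::nat. if i = 1 then A else B"
  have sub: "A \<subseteq> carrier M" "B \<subseteq> carrier M"
    using AB submoduleD(1) by (auto simp: direct_summand_def)
  \<comment> \<open>Writing 2 with successors lets \<open>submodule_sum_Suc\<close> split off both
    terms, leaving the zero submodule of the empty sum in front.\<close>
  have "submodule_sum M (Suc (Suc 0)) ?X = ({\<zero>\<^bsub>M\<^esub>} <+>\<^bsub>M\<^esub> A) <+>\<^bsub>M\<^esub> B"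
    using sub by (simp add: submodule_sum_Suc submodule_sum_0)
  moreover have "{\<zero>\<^bsub>M\<^esub>} <+>\<^bsub>M\<^esub> A = A"
    using sub(1) by (force simp: set_add_iff)
  ultimately have "submodule_sum M 2 ?X = A <+>\<^bsub>M\<^esub> B" by (simp add: numeral_2_eq_2)
  moreover have "direct_summand (submodule_sum M 2 ?X) R M"
    using assms AB unfolding summand_sums_def by simp
  ultimately show "direct_summand (A <+>\<^bsub>M\<^esub> B) R M" by simp
qed

end

theorem proposition2p13:
  fixes R :: "('r, 'c) ring_scheme" and M :: "('r, 'm) module" and \<A> :: "('r, 'm) module set"
  assumes "ring R"
    and "right_module R M"
    and "\<And>N. N \<in> \<A> \<Longrightarrow> right_module R N \<and> artinian_module R N"
    and "closed_under_iso R \<A>"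
    and "closed_under_summands R \<A>"
    and "\<And>N. submodule N R M \<Longrightarrow> class_projective R \<A> (restrict_mod M N)"
  shows "(class_C3 R \<A> M
            \<longleftrightarrow>
          (\<forall>N. submodule N R M \<and> restrict_mod M N \<in> \<A> \<and>
            (\<exists>X. direct_summand X R M \<and> mod_isomorphic R (restrict_mod M N) (restrict_mod M X))
            \<longrightarrow> direct_summand N R M))
        \<and>
         ((\<forall>N. submodule N R M \<and> restrict_mod M N \<in> \<A> \<and>
            (\<exists>X. direct_summand X R M \<and> mod_isomorphic R (restrict_mod M N) (restrict_mod M X))
            \<longrightarrow> direct_summand N R M)
            \<longleftrightarrow>
          (\<forall>n\<ge>1. \<forall>X :: nat \<Rightarrow> 'm set.
            (\<forall>i\<in>{1..n}. direct_summand (X i) R M \<and> restrict_mod M (X i) \<in> \<A>)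
            \<longrightarrow> direct_summand (submodule_sum M n X) R M))"
proof -
  interpret right_module R M by (rule assms(2))
  interpret projective_class R M \<A>
    by unfold_locales (use assms(3-6) in auto)
  \<comment> \<open>The three implications form a cycle, from which both equivalences
    follow.\<close>
  have "(class_C3 R \<A> M \<longleftrightarrow> C2) \<and> (C2 \<longleftrightarrow> summand_sums)"
    using C3_imp_C2 C2_imp_summand_sums summand_sums_imp_C3 by blast
  then show ?thesis unfolding C2_def summand_sums_def .
qed

end
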